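(* Let $\mathbb{F}=\mathbb{R}$ or $\mathbb{C}$ and let $n,p$ be integers with $2\le p\le n-2$. The Plücker-like equations $\mathcal{Q}(\mathbf{j},\mathbf{k})=0$, for $(\mathbf{j},\mathbf{k})\in\mathcal{I}^n_{p-2}\times\mathcal{I}^n_{p+2}$, are all distinct and non-trivial. The system of these equations consists of: (i) $\binom{n}{4,\,p-2,\,n-p-2}$ equations which are usual Plücker equations of $3$ terms. (ii) If $3\le p\le n-3$, $\binom{n}{1,\,5,\,p-3,\,n-p-3}$ equations of $10$ terms. They are partitioned into $\binom{n}{6,\,p-3,\,n-p-3}$ sets of $6$ equations $\{E_1,\ldots,E_6\}$ with the same terms (up to signs), such that, for each set (with its equations suitably ordered) there is a set of $15$ usual Plücker equations of $4$ terms such that, for all $1\le i<i'\le 6$, $E_i+(-1)^{i+i'}E_{i'}$ gives one of these $15$ equations. (iii) For each integer $q$ with $\max\{0,2p-n\}\le q\le p-4$, $\binom{n}{q,\,p-2-q,\,p+2-q,\,n+q-2p}$ equations of $\binom{p+2-q}{2}\ge 15$ terms.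
   Context: For integers $0\le r\le n$, $\mathcal{I}^n_r=\{(i_1,\ldots,i_r)\in\mathbb{N}^r: 1\le i_1<\cdots<i_r\le n\}$; its elements (multi-indices) are identified with the $r$-element subsets of $\{1,\ldots,n\}$. For multi-indices $\mathbf{i},\mathbf{j}$, the symbols $\mathbf{i}\cup\mathbf{j}$, $\mathbf{i}\setminus\mathbf{j}$, $\mathbf{i}\triangle\mathbf{j}$ denote the union, difference and symmetric difference, written in increasing order, and $|\mathbf{i}>\mathbf{j}|$ denotes the number of pairs $(i,j)$ with $i\in\mathbf{i}$, $j\in\mathbf{j}$ and $i>j$. A single index $i$ is identified with the multi-index $(i)$. The multinomial $\binom{n}{n_1,\ldots,n_k}=\frac{n!}{n_1!\cdots n_k!}$, for $n=n_1+\cdots+n_k$, is the number of ways to partition $n$ elements into $k$ (labelled) subsets of $n_1,\ldots,n_k$ elements. Let $\lambda_{\mathbf{i}}$, $\mathbf{i}\in\mathcal{I}^n_p$, be variables over $\mathbb{F}$ (they stand for the coordinates of a $p$-vector $H=\sum_{\mathbf{i}\in\mathcal{I}^n_p}\lambda_{\mathbf{i}}\,v_{i_1}\wedge\cdots\wedge v_{i_p}\in\bigwedge^p\mathbb{F}^n$ in an orthonormal basis $(v_1,\ldots,v_n)$ of $\mathbb{F}^n$). Equations are regarded as formal homogeneous quadratic equations, with left-hand sides in the polynomial ring $\mathbb{F}[\lambda_{\mathbf{i}}:\mathbf{i}\in\mathcal{I}^n_p]$. The usual Plücker equations are $\mathcal{P}(\mathbf{j},\mathbf{k})=0$ for all $\mathbf{j}\in\mathcal{I}^n_{p-1}$,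 $\mathbf{k}\in\mathcal{I}^n_{p+1}$, where $$\mathcal{P}(\mathbf{j},\mathbf{k})=\sum_{i\in\mathbf{k}\setminus\mathbf{j}}(-1)^{|\mathbf{j}\triangle\mathbf{k}>i|}\,\lambda_{\mathbf{j}\cup i}\,\lambda_{\mathbf{k}\setminus i}.$$ The Plücker-like equations are $\mathcal{Q}(\mathbf{j},\mathbf{k})=0$ for all $\mathbf{j}\in\mathcal{I}^n_{p-2}$, $\mathbf{k}\in\mathcal{I}^n_{p+2}$, where $$\mathcal{Q}(\mathbf{j},\mathbf{k})=\sum_{\mathbf{i}\in\mathcal{I}^n_2,\ \mathbf{i}\subset\mathbf{k}\setminus\mathbf{j}}(-1)^{|\mathbf{j}\triangle\mathbf{k}>\mathbf{i}|}\,\lambda_{\mathbf{j}\cup\mathbf{i}}\,\lambda_{\mathbf{k}\setminus\mathbf{i}}.$$ Conventions. An equation is trivial if its left-hand side is the zero polynomial. Two equations are considered the same if their left-hand sides are nonzero constant multiples of each other, and distinct otherwise; likewise "is a usual Plücker equation" and "gives a usual Plücker equation" are understood up to a nonzero constant factor. The number of terms of an equation is the number of distinct monomials with nonzero coefficient in its left-hand side after collecting like terms. Equations have "the same terms" if the same monomials occur in them, possibly with different signs. In (ii), in the expression $E_i+(-1)^{i+i'}E_{i'}$ each $E_i$ stands for the left-hand side $\mathcal{Q}(\mathbf{j},\mathbf{k})$ of the corresponding equation, with the signs exactly as in the formula above. "The system consists of" means that the equations listed in (i), (ii) (present only if $3\le p\le n-3$) and (iii) (present only for the integers $q$ in the indicated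 range, if any) are, together, all the equations of the system, each counted once. *)

theory Defs
  imports Complex_Main "HOL-Library.Poly_Mapping" "HOL-Library.Disjoint_Sets"
begin

text \<open>
  The ground field is a type \<open>'a\<close> of class \<^class>\<open>real_normed_field\<close>, which has the instances
  \<^typ>\<open>real\<close> and \<^typ>\<open>complex\<close> and, by the Gelfand--Mazur theorem, no others up to isomorphism.
  The variables are indexed by \<^typ>\<open>nat set\<close>; only those indexed by \<open>p\<close>-element subsets of
  \<open>{1..n}\<close> occur in the polynomials below. A polynomial maps monomials (exponent functions) to
  coefficients.
\<close>

type_synonym 'a lpoly = "(nat set \<Rightarrow>\<^sub>0 nat) \<Rightarrow>\<^sub>0 'a"

definition lvar :: "nat set \<Rightarrow> 'a::real_normed_field lpoly" where
  "lvar i = Poly_Mapping.single (Poly_Mapping.single i 1) 1"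

definition multi_indices :: "nat \<Rightarrow> nat \<Rightarrow> nat set set" where
  "multi_indices n r = {i. i \<subseteq> {1..n} \<and> card i = r}"

definition num_gt :: "nat set \<Rightarrow> nat set \<Rightarrow> nat" where
  "num_gt i j = card {(a, b). a \<in> i \<and> b \<in> j \<and> a > b}"

text \<open>Meant for \<open>n = sum_list ms\<close>, when the division is exact.\<close>

definition multinomial :: "nat \<Rightarrow> nat list \<Rightarrow> nat" where
  "multinomial n ms = fact n div (\<Prod>m\<leftarrow>ms. fact m)"

definition plucker :: "nat set \<Rightarrow> nat set \<Rightarrow> 'a::real_normed_field lpoly" where
  "plucker j k =
     (\<Sum>i\<in>k - j. (- 1) ^ num_gt (sym_diff j k) {i} * lvar (j \<union> {i}) * lvar (k - {i}))"

definition plucker_like :: "nat \<Rightarrow> nat set \<Rightarrow> nat set \<Rightarrow> 'a::real_normed_field lpoly" where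
  "plucker_like n j k =
     (\<Sum>i\<in>{i \<in> multi_indices n 2. i \<subseteq> k - j}.
        (- 1) ^ num_gt (sym_diff j k) i * lvar (j \<union> i) * lvar (k - i))"

text \<open>Equations are represented by their left-hand sides.\<close>

definition plucker_eqs :: "nat \<Rightarrow> nat \<Rightarrow> 'a::real_normed_field lpoly set" where
  "plucker_eqs n p =
     {plucker j k | j k. j \<in> multi_indices n (p - 1) \<and> k \<in> multi_indices n (p + 1)}"

definition plucker_like_eqs :: "nat \<Rightarrow> nat \<Rightarrow> 'a::real_normed_field lpoly set" where
  "plucker_like_eqs n p =
     {plucker_like n j k | j k. j \<in> multi_indices n (p - 2) \<and> k \<in> multi_indices n (p + 2)}"

definition same_eqn :: "'a::real_normed_field lpoly \<Rightarrow> 'a lpoly \<Rightarrow> bool" where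
  "same_eqn f g \<longleftrightarrow> (\<exists>c. c \<noteq> 0 \<and> f = Poly_Mapping.single 0 c * g)"

definition gives_eqn_of :: "'a::real_normed_field lpoly \<Rightarrow> 'a lpoly set \<Rightarrow> bool" where
  "gives_eqn_of f W \<longleftrightarrow> (\<exists>g\<in>W. same_eqn f g)"

definition num_terms :: "'a::real_normed_field lpoly \<Rightarrow> nat" where
  "num_terms f = card (Poly_Mapping.keys f)"

definition same_terms :: "'a::real_normed_field lpoly \<Rightarrow> 'a lpoly \<Rightarrow> bool" where
  "same_terms f g \<longleftrightarrow>
     (\<forall>m. Poly_Mapping.lookup f m = Poly_Mapping.lookup g m \<or>
          Poly_Mapping.lookup f m = - Poly_Mapping.lookup g m)"

end

theory Submission
  imports Defs
begin

text \<open>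
  Everything is read off from one family of quadratic forms. Put \<open>c = j \<inter> k\<close>, \<open>J = j - k\<close>
  and let \<open>S\<close> be the symmetric difference of \<open>j\<close> and \<open>k\<close>. A term of a Pluecker or
  Pluecker-like polynomial moves one or two indices from \<open>k - j\<close> to \<open>j\<close>. Both then have
  \<open>p\<close> elements, so the term splits \<open>S\<close> into two halves \<open>T\<close> and \<open>S - T\<close> of equal size \<open>t\<close>,
  with \<open>J \<subseteq> T\<close>, and its monomial is the product of the variables indexed by \<open>c \<union> T\<close> and
  \<open>c \<union> (S - T)\<close>. Up to the constant sign of \<open>J\<close>, its sign is the sign of \<open>T\<close>: minus one to
  the power of the number of pairs in \<open>S \<times> T\<close> with larger first entry. Hence both kinds of polynomials are,
  up to sign, equal to \<open>F(J)\<close>, the sum of these signed monomials over the halves \<open>T\<close> of \<open>S\<close>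
  that contain \<open>J\<close>. They differ only in the size of \<open>J\<close>: it is \<open>t - 1\<close> for the usual
  equations and \<open>t - 2\<close> for the Pluecker-like ones
  (\<open>plucker_eq_halving_form\<close>, \<open>plucker_like_eq_halving_form\<close>).

  The two halves of one splitting give the same monomial, and their signs differ by the factor
  \<open>(-1)^t\<close>, because the sign of \<open>S\<close> itself is \<open>(-1)^(t (2 t - 1))\<close>
  (\<open>crossing_sign_complement\<close>). This yields two linear relations
  (\<open>halving_form_empty\<close>, \<open>halving_form_add\<close>).
  For even \<open>t\<close>, the two halves reinforce each other, and \<open>F({}) = 2 F({x})\<close>. For odd \<open>t\<close>, the
  halves that separate \<open>x\<close> and \<open>y\<close> cancel in \<open>F({x}) + F({y})\<close>, which leaves
  \<open>2 F({x, y})\<close>. With \<open>t = 2\<close> the first relation turns a Pluecker-like equation with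
  \<open>j \<subseteq> k\<close> into a usual one of three terms. With \<open>t = 3\<close> the second one turns sums of the
  equations \<open>F({x})\<close>, for the six elements \<open>x\<close> of \<open>S\<close>, into usual equations of four terms;
  the signs \<open>(-1)^(i + i')\<close> compensate for the signs of the singletons \<open>{x}\<close>.

  If \<open>J\<close> is nonempty, it tells the two halves of a splitting apart, so no terms of \<open>F(J)\<close>
  collect, and the number of terms is the number of halves that contain \<open>J\<close>. Moreover a single
  monomial determines \<open>c\<close> and \<open>S\<close>, as intersection and union of the two index sets in it. The
  monomials also determine \<open>J\<close> once it has at least two elements. For one element they do not,
  but for odd \<open>t\<close> the coefficients do (\<open>same_eqn_halving_form_inject\<close>).
  Hence the Pluecker-like equations are pairwise distinct, and counting those with \<open>card (j \<inter> k) = q\<close> means counting pairs of sets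
  (\<open>card_pairs_eq_multinomial\<close>). The cases \<open>q = p - 2\<close>, \<open>q = p - 3\<close> and \<open>q \<le> p - 4\<close> are
  the three classes of the theorem.
\<close>

section \<open>Crossing signs\<close>

lemma num_gt_eq_sum:
  assumes "finite S" "finite T"
  shows "num_gt S T = (\<Sum>t\<in>T. num_gt S {t})"
proof -
  have fin: "finite {(a, b). a \<in> S \<and> b = t \<and> a > b}" for t
    by (rule finite_subset[of _ "S \<times> {t}"]) (use assms in auto)
  have "{(a, b). a \<in> S \<and> b \<in> T \<and> a > b} = (\<Union>t\<in>T. {(a, b). a \<in> S \<and> b = t \<and> a > b})"
    by auto
  then show ?thesis
    unfolding num_gt_def using assms fin by (simp, subst card_UN_disjoint) auto
qed

lemma num_gt_singleton: "num_gt S {t} = card {a \<in> S. t < a}"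
proof -
  have "{(a, b). a \<in> S \<and> b \<in> {t} \<and> a > b} = (\<lambda>a. (a, t)) ` {a \<in> S. t < a}"
    by auto
  then show ?thesis
    unfolding num_gt_def by (simp add: card_image inj_on_def)
qed

text \<open>
  The number of elements of \<open>S\<close> above \<open>s\<close> is the position of \<open>s\<close> in the decreasing order. This
  evaluates the sign of \<open>S\<close> itself, and later lists the elements of a six-element set so that
  the signs of the singletons alternate.
\<close>

lemma bij_betw_num_gt_singleton:
  assumes "finite S"
  shows "bij_betw (\<lambda>s. num_gt S {s}) S {..<card S}"
proof -
  have less: "num_gt S {t} < num_gt S {s}" if "s < t" "t \<in> S" for s t
    unfolding num_gt_singleton using assms that by (intro psubset_card_mono) auto
  have inj: "inj_on (\<lambda>s. num_gt S {s}) S"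
    by (rule inj_onI) (metis less less_irrefl nat_neq_iff)
  have "num_gt S {s} < card S" if "s \<in> S" for s
    unfolding num_gt_singleton using assms that by (intro psubset_card_mono) auto
  then have sub: "(\<lambda>s. num_gt S {s}) ` S \<subseteq> {..<card S}"
    by auto
  have "(\<lambda>s. num_gt S {s}) ` S = {..<card S}"
    by (rule card_subset_eq) (use sub inj in \<open>auto simp: card_image\<close>)
  then show ?thesis
    using inj by (simp add: bij_betw_def)
qed

definition crossing_sign :: "nat set \<Rightarrow> nat set \<Rightarrow> 'a::real_normed_field" where
  "crossing_sign S T = (- 1) ^ num_gt S T"

lemma crossing_sign_cases:
  "crossing_sign S T = (1::'a::real_normed_field) \<or> crossing_sign S T = (- 1::'a)"
  unfolding crossing_sign_def by (cases "even (num_gt S T)") auto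

lemma crossing_sign_square [simp]:
  "crossing_sign S T * crossing_sign S T = (1::'a::real_normed_field)"
  using crossing_sign_cases[where 'a = 'a, of S T] by auto

lemma crossing_sign_nonzero [simp]: "crossing_sign S T \<noteq> (0::'a::real_normed_field)"
  by (simp add: crossing_sign_def)

lemma crossing_sign_empty [simp]: "crossing_sign S {} = 1"
  by (simp add: crossing_sign_def num_gt_def)

lemma crossing_sign_Un:
  assumes "finite S" "finite A" "finite B" "A \<inter> B = {}"
  shows "crossing_sign S (A \<union> B) = crossing_sign S A * (crossing_sign S B :: 'a::real_normed_field)"
proof -
  have "num_gt S (A \<union> B) = num_gt S A + num_gt S B"
    using assms
    by (simp add: num_gt_eq_sum[of S "A \<union> B"] num_gt_eq_sum[of S A] num_gt_eq_sum[of S B]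
        sum.union_disjoint)
  then show ?thesis
    by (simp add: crossing_sign_def power_add)
qed

text \<open>
  By the preceding bijection, the exponent is \<open>0 + 1 + \<dots> + (2 t - 1)\<close>, a sum of \<open>2 t\<close>
  consecutive numbers of which \<open>t\<close> are odd.
\<close>

lemma crossing_sign_self:
  assumes "finite S" "card S = 2 * t"
  shows "crossing_sign S S = ((- 1) ^ t :: 'a::real_normed_field)"
proof -
  have "num_gt S S = (\<Sum>s\<in>S. num_gt S {s})"
    using assms by (intro num_gt_eq_sum)
  also have "\<dots> = \<Sum>{..<card S}"
    by (rule sum.reindex_bij_betw[OF bij_betw_num_gt_singleton[OF assms(1)]])
  finally have "num_gt S S = \<Sum>{..<2 * t}"
    using assms by simp
  moreover have "(- 1) ^ \<Sum>{..<2 * t} = ((- 1) ^ t :: 'a)" for t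
    by (induction t) (auto simp: power_add)
  ultimately show ?thesis
    by (simp add: crossing_sign_def)
qed

lemma crossing_sign_complement:
  assumes "finite S" "card S = 2 * t" "T \<subseteq> S"
  shows "crossing_sign S (S - T) = (- 1) ^ t * (crossing_sign S T :: 'a::real_normed_field)"
proof -
  have "crossing_sign S T * crossing_sign S (S - T) = (crossing_sign S (T \<union> (S - T)) :: 'a)"
    using assms by (intro crossing_sign_Un[symmetric]) (auto intro: finite_subset)
  also have "T \<union> (S - T) = S"
    using assms by auto
  finally have "crossing_sign S T * crossing_sign S (S - T) = ((- 1) ^ t :: 'a)"
    using assms crossing_sign_self by metis
  then have "crossing_sign S T * (crossing_sign S T * crossing_sign S (S - T))
      = ((- 1) ^ t * crossing_sign S T :: 'a)"
    by simp
  then show ?thesis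
    by (simp add: mult.assoc[symmetric])
qed

section \<open>Scaling polynomials\<close>

lemma lookup_scale:
  "Poly_Mapping.lookup (Poly_Mapping.single 0 a * f) m = a * Poly_Mapping.lookup f m"
  for f :: "'a::real_normed_field lpoly"
  unfolding mult_map_scale_conv_mult[symmetric] by (simp add: Poly_Mapping.map.rep_eq when_def)

lemma scale_scale:
  "Poly_Mapping.single 0 a * (Poly_Mapping.single 0 b * f) = Poly_Mapping.single 0 (a * b) * f"
  for f :: "'a::real_normed_field lpoly"
  by (simp add: mult.assoc[symmetric] mult_single)

lemma keys_scale:
  "a \<noteq> 0 \<Longrightarrow> Poly_Mapping.keys (Poly_Mapping.single 0 a * f) = Poly_Mapping.keys f"
  for f :: "'a::real_normed_field lpoly"
  by (auto simp: in_keys_iff lookup_scale)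

lemma keys_same_eqn: "same_eqn f g \<Longrightarrow> Poly_Mapping.keys f = Poly_Mapping.keys g"
  by (auto simp: same_eqn_def keys_scale)

lemma same_eqn_refl: "same_eqn f f"
  unfolding same_eqn_def by (intro exI[of _ 1]) simp

lemma same_eqn_scale_iff:
  assumes "a \<noteq> 0" "b \<noteq> 0"
  shows "same_eqn (Poly_Mapping.single 0 a * f) (Poly_Mapping.single 0 b * g) \<longleftrightarrow> same_eqn f g"
proof
  assume "same_eqn (Poly_Mapping.single 0 a * f) (Poly_Mapping.single 0 b * g)"
  then obtain x where "x \<noteq> 0"
    "Poly_Mapping.single 0 a * f = Poly_Mapping.single 0 x * (Poly_Mapping.single 0 b * g)"
    by (auto simp: same_eqn_def)
  then have "Poly_Mapping.single 0 (1 / a) * (Poly_Mapping.single 0 a * f)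
      = Poly_Mapping.single 0 (1 / a) * (Poly_Mapping.single 0 x * (Poly_Mapping.single 0 b * g))"
    by simp
  then have "f = Poly_Mapping.single 0 (x * b / a) * g"
    using assms by (simp add: scale_scale)
  then show "same_eqn f g"
    using assms \<open>x \<noteq> 0\<close> by (auto simp: same_eqn_def intro!: exI[of _ "x * b / a"])
next
  assume "same_eqn f g"
  then obtain x where x: "x \<noteq> 0" "f = Poly_Mapping.single 0 x * g"
    by (auto simp: same_eqn_def)
  then have "Poly_Mapping.single 0 a * f
      = Poly_Mapping.single 0 (a * x / b) * (Poly_Mapping.single 0 b * g)"
    using assms by (simp add: scale_scale)
  then show "same_eqn (Poly_Mapping.single 0 a * f) (Poly_Mapping.single 0 b * g)"
    using assms x by (auto simp: same_eqn_def intro!: exI[of _ "a * x / b"])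
qed

section \<open>Halving forms\<close>

text \<open>
  The exponents of the product of the variables indexed by \<open>c \<union> T\<close> and \<open>c \<union> (S - T)\<close>.
\<close>

definition halving_monom :: "nat set \<Rightarrow> nat set \<Rightarrow> nat set \<Rightarrow> nat set \<Rightarrow>\<^sub>0 nat" where
  "halving_monom c S T = Poly_Mapping.single (c \<union> T) 1 + Poly_Mapping.single (c \<union> (S - T)) 1"

lemma keys_halving_monom: "Poly_Mapping.keys (halving_monom c S T) = {c \<union> T, c \<union> (S - T)}"
proof -
  have "Poly_Mapping.keys (Poly_Mapping.single a (1::nat) + Poly_Mapping.single b 1) = {a, b}"
    for a b :: "nat set"
    by (rule set_eqI)
      (simp add: in_keys_iff lookup_add lookup_single when_def eq_commute[of _ a] eq_commute[of _ b])
  then show ?thesis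
    by (simp add: halving_monom_def)
qed

lemma halving_monom_complement:
  assumes "T \<subseteq> S"
  shows "halving_monom c S (S - T) = halving_monom c S T"
  using assms by (simp add: halving_monom_def double_diff add.commute)

text \<open>
  The two index sets in the monomial are known as an unordered pair. Their intersection is \<open>c\<close>
  and their union is \<open>c \<union> S\<close>, and either of them may be the one that contains \<open>T\<close>.
\<close>

lemma halving_monom_eqD:
  assumes "halving_monom c S T = halving_monom c' S' T'"
    and "c \<inter> S = {}" "c' \<inter> S' = {}" "T \<subseteq> S" "T' \<subseteq> S'"
  shows "c = c'" and "S = S'" and "T = T' \<or> T = S - T'"
proof -
  have keys: "{c \<union> T, c \<union> (S - T)} = {c' \<union> T', c' \<union> (S' - T')}"
    using assms(1) by (simp flip: keys_halving_monom)
  then have "\<Inter>{c \<union> T, c \<union> (S - T)} = \<Inter>{c' \<union> T', c' \<union> (S' - T')}"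
    by simp
  then show c: "c = c'"
    using assms by auto
  from keys have "\<Union>{c \<union> T, c \<union> (S - T)} = \<Union>{c' \<union> T', c' \<union> (S' - T')}"
    by simp
  then have "c \<union> S = c' \<union> S'"
    using assms by auto
  then show S: "S = S'"
    using assms c by blast
  have "c \<union> T = c \<union> T' \<or> c \<union> T = c \<union> (S - T')"
    using keys c S by (auto simp: doubleton_eq_iff)
  then show "T = T' \<or> T = S - T'"
    using assms c S by blast
qed

definition halves :: "nat set \<Rightarrow> nat set \<Rightarrow> nat set set" where
  "halves S J = {T. J \<subseteq> T \<and> T \<subseteq> S \<and> 2 * card T = card S}"

definition halving_form :: "nat set \<Rightarrow> nat set \<Rightarrow> nat set \<Rightarrow> 'a::real_normed_field lpoly" where
  "halving_form c S J =
     (\<Sum>T\<in>halves S J. Poly_Mapping.single (halving_monom c S T) (crossing_sign S T))"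

lemma finite_halves [simp]: "finite S \<Longrightarrow> finite (halves S J)"
  by (rule finite_subset[of _ "Pow S"]) (auto simp: halves_def)

lemma halves_complement:
  assumes "finite S" "T \<in> halves S {}"
  shows "S - T \<in> halves S {}"
proof -
  have "T \<subseteq> S" "2 * card T = card S"
    using assms by (auto simp: halves_def)
  moreover from this have "card (S - T) = card S - card T"
    using assms by (intro card_Diff_subset) (auto intro: finite_subset)
  ultimately show ?thesis
    by (auto simp: halves_def)
qed

lemma card_halves:
  assumes "finite S" "card S = 2 * t" "J \<subseteq> S" "card J \<le> t"
  shows "card (halves S J) = (card S - card J) choose (t - card J)"
proof -
  have finJ: "finite J"
    using finite_subset[OF assms(3,1)] .
  have "bij_betw (\<lambda>I. J \<union> I) {I. I \<subseteq> S - J \<and> card I = t - card J} (halves S J)"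
  proof (rule bij_betwI[where g = "\<lambda>T. T - J"])
    show "(\<lambda>I. J \<union> I) \<in> {I. I \<subseteq> S - J \<and> card I = t - card J} \<rightarrow> halves S J"
    proof
      fix I assume "I \<in> {I. I \<subseteq> S - J \<and> card I = t - card J}"
      then have I: "I \<subseteq> S - J" "card I = t - card J" by auto
      then have "finite I" "J \<inter> I = {}"
        using assms by (auto intro: finite_subset)
      then have "card (J \<union> I) = card J + card I"
        using finJ by (intro card_Un_disjoint)
      then show "J \<union> I \<in> halves S J"
        using I assms by (auto simp: halves_def)
    qed
    show "(\<lambda>T. T - J) \<in> halves S J \<rightarrow> {I. I \<subseteq> S - J \<and> card I = t - card J}"
      using assms finJ by (auto simp: halves_def card_Diff_subset)
  qed (auto simp: halves_def)
  then have "card (halves S J) = card {I. I \<subseteq> S - J \<and> card I = t - card J}"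
    using bij_betw_same_card by metis
  also have "\<dots> = (card S - card J) choose (t - card J)"
    using assms finJ by (simp add: n_subsets card_Diff_subset)
  finally show ?thesis .
qed

text \<open>
  A half and its complement give the same monomial, but only one of them contains \<open>J\<close>.
\<close>

lemma halving_monom_inj_on:
  assumes "c \<inter> S = {}" "J \<noteq> {}"
  shows "inj_on (halving_monom c S) (halves S J)"
proof (rule inj_onI)
  fix T U assume "T \<in> halves S J" "U \<in> halves S J" "halving_monom c S T = halving_monom c S U"
  moreover from this have "T = U \<or> T = S - U"
    using assms by (intro halving_monom_eqD(3)) (auto simp: halves_def)
  ultimately show "T = U"
    using assms by (auto simp: halves_def)
qed

lemma lookup_halving_form:
  assumes "finite S" "c \<inter> S = {}" "J \<noteq> {}" "T \<in> halves S J"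
  shows "Poly_Mapping.lookup (halving_form c S J) (halving_monom c S T)
    = (crossing_sign S T :: 'a::real_normed_field)"
proof -
  have eq: "halving_monom c S U = halving_monom c S T \<longleftrightarrow> U = T" if "U \<in> halves S J" for U
    using halving_monom_inj_on[OF assms(2,3)] assms(4) that by (auto dest: inj_onD)
  have "Poly_Mapping.lookup (halving_form c S J) (halving_monom c S T)
      = (\<Sum>U\<in>halves S J. crossing_sign S U when halving_monom c S U = halving_monom c S T)"
    by (simp add: halving_form_def lookup_sum lookup_single)
  also have "\<dots> = (\<Sum>U\<in>halves S J. if U = T then crossing_sign S U else (0::'a))"
    by (intro sum.cong) (auto simp: eq when_def)
  finally show ?thesis
    using assms by simp
qed

lemma keys_halving_form:
  assumes "finite S" "c \<inter> S = {}" "J \<noteq> {}"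
  shows "Poly_Mapping.keys (halving_form c S J :: 'a::real_normed_field lpoly)
    = halving_monom c S ` halves S J"
proof
  show "Poly_Mapping.keys (halving_form c S J :: 'a lpoly) \<subseteq> halving_monom c S ` halves S J"
  proof
    fix m assume "m \<in> Poly_Mapping.keys (halving_form c S J :: 'a lpoly)"
    then have "(\<Sum>U\<in>halves S J. crossing_sign S U when halving_monom c S U = m) \<noteq> (0::'a)"
      by (simp add: in_keys_iff halving_form_def lookup_sum lookup_single)
    then obtain U where "U \<in> halves S J" "(crossing_sign S U when halving_monom c S U = m) \<noteq> (0::'a)"
      by (meson sum.neutral)
    then show "m \<in> halving_monom c S ` halves S J"
      by (auto simp: when_def split: if_splits)
  qed
  show "halving_monom c S ` halves S J \<subseteq> Poly_Mapping.keys (halving_form c S J :: 'a lpoly)"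
    using assms by (simp add: image_subset_iff in_keys_iff lookup_halving_form)
qed

lemma num_terms_halving_form:
  assumes "finite S" "card S = 2 * t" "c \<inter> S = {}" "J \<subseteq> S" "J \<noteq> {}" "card J \<le> t"
  shows "num_terms (halving_form c S J :: 'a::real_normed_field lpoly)
    = (card S - card J) choose (t - card J)"
  unfolding num_terms_def keys_halving_form[OF assms(1,3,5)]
  using card_halves[OF assms(1,2,4,6)] halving_monom_inj_on[OF assms(3,5)]
  by (simp add: card_image)

lemma same_eqn_halving_formD:
  assumes "same_eqn (halving_form c S J :: 'a::real_normed_field lpoly) (halving_form c' S' J')"
    and "finite S" "c \<inter> S = {}" "J \<noteq> {}" "J \<subseteq> S" "card S = 2 * t" "card J \<le> t"
    and "finite S'" "c' \<inter> S' = {}" "J' \<noteq> {}"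
  shows "c = c'" and "S = S'"
proof -
  have eq: "halving_monom c S ` halves S J = halving_monom c' S' ` halves S' J'"
    using keys_same_eqn[OF assms(1)] assms by (simp add: keys_halving_form)
  have "card (halves S J) \<noteq> 0"
    using assms by (subst card_halves) (auto simp: binomial_eq_0_iff)
  then obtain T where T: "T \<in> halves S J"
    by fastforce
  with eq obtain T' where T': "T' \<in> halves S' J'" "halving_monom c S T = halving_monom c' S' T'"
    by blast
  show "c = c'" "S = S'"
    using halving_monom_eqD[OF T'(2)] T T' assms by (auto simp: halves_def)
qed

text \<open>
  Removing \<open>x\<close> leaves \<open>2 * t - 1 \<ge> t\<close> elements, enough to extend \<open>J\<close> to a half.
\<close>

lemma ex_halves_avoiding:
  assumes "finite S" "card S = 2 * t" "J \<subseteq> S" "card J \<le> t" "x \<in> S" "x \<notin> J" "0 < t"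
  obtains T where "T \<in> halves S J" "x \<notin> T"
proof -
  have "card (S - {x}) = 2 * t - 1"
    using assms by simp
  then have "t \<le> card (S - {x})" "J \<subseteq> S - {x}" "finite (S - {x})"
    using assms by auto
  then obtain T where "J \<subseteq> T" "T \<subseteq> S - {x}" "card T = t"
    using exists_subset_between[of J t "S - {x}"] assms(4) by blast
  with that show ?thesis
    using assms by (auto simp: halves_def)
qed

text \<open>
  Suppose that \<open>x\<close> lies in \<open>J'\<close> but not in \<open>J\<close>. If \<open>J'\<close> has another element \<open>y\<close>, some half
  contains \<open>J\<close> and \<open>y\<close> but not \<open>x\<close>. It separates \<open>J'\<close>, so its monomial occurs in the form
  of \<open>J\<close> only. If \<open>J = {y}\<close> and \<open>J' = {x}\<close>, the two forms have the same monomials, and the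
  coefficients decide: they agree on the halves that contain both \<open>x\<close> and \<open>y\<close>, and for odd \<open>t\<close>
  they are opposite on the halves that separate \<open>x\<close> from \<open>y\<close>, so no constant relates the forms.
  For even \<open>t\<close> the forms of all singletons coincide.
\<close>

lemma same_eqn_halving_form_inject:
  assumes "same_eqn (halving_form c S J :: 'a::real_normed_field lpoly) (halving_form c S J')"
    and "finite S" "c \<inter> S = {}" "card S = 2 * t"
    and "J \<subseteq> S" "J' \<subseteq> S" "card J' = card J" "J \<noteq> {}" "card J < t"
    and "2 \<le> card J \<or> odd t"
  shows "J = J'"
proof (rule ccontr)
  assume "J \<noteq> J'"
  have fin: "finite J" "finite J'"
    using finite_subset[OF assms(5,2)] finite_subset[OF assms(6,2)] by simp_all
  have "J' \<noteq> {}"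
    using assms fin by auto
  have keys: "halving_monom c S ` halves S J = halving_monom c S ` halves S J'"
    using keys_same_eqn[OF assms(1)] assms \<open>J' \<noteq> {}\<close> by (simp add: keys_halving_form)
  obtain x where x: "x \<in> J'" "x \<notin> J"
    using \<open>J \<noteq> J'\<close> assms(7) fin card_subset_eq[of J J'] by auto
  show False
  proof (cases "2 \<le> card J")
    case True
    then have "\<not> J' \<subseteq> {x}"
      using assms(7) card_mono[of "{x}" J'] by auto
    then obtain y where y: "y \<in> J'" "y \<noteq> x"
      by auto
    have le: "card (insert y J) \<le> t"
      using assms(9) by (simp add: card_insert_if fin)
    obtain T where T: "T \<in> halves S (insert y J)" "x \<notin> T"
      by (rule ex_halves_avoiding[of S t "insert y J" x]) (use assms x y le in auto)
    then have "halving_monom c S T \<in> halving_monom c S ` halves S J'"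
      unfolding keys[symmetric] by (auto simp: halves_def)
    then obtain T' where T': "T' \<in> halves S J'" "halving_monom c S T = halving_monom c S T'"
      by auto
    then have "T = T' \<or> T = S - T'"
      using T assms by (intro halving_monom_eqD(3)) (auto simp: halves_def)
    then show False
      using T T' x y by (auto simp: halves_def)
  next
    case False
    then have one: "card J = 1" "odd t"
      using assms fin by (auto simp: not_le numeral_2_eq_2 less_Suc_eq)
    then obtain y where y: "J = {y}"
      by (auto simp: card_1_singleton_iff)
    have J': "J' = {x}"
      using x one assms by (metis card_1_singletonE singletonD)
    obtain a :: 'a where a: "halving_form c S J = Poly_Mapping.single 0 a * halving_form c S J'"
      using assms(1) by (auto simp: same_eqn_def)
    have "x \<noteq> y"
      using x y by auto
    have "card {x, y} \<le> t" "{x, y} \<subseteq> S"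
      using \<open>x \<noteq> y\<close> assms one y J' by auto
    have "card (halves S {x, y}) \<noteq> 0"
      using assms \<open>card {x, y} \<le> t\<close> \<open>{x, y} \<subseteq> S\<close> by (subst card_halves) (auto simp: binomial_eq_0_iff)
    then obtain T where T: "T \<in> halves S {x, y}"
      by fastforce
    have "Poly_Mapping.lookup (halving_form c S J) (halving_monom c S T)
        = a * Poly_Mapping.lookup (halving_form c S J') (halving_monom c S T)"
      unfolding a by (rule lookup_scale)
    moreover have "T \<in> halves S J" "T \<in> halves S J'"
      using T y J' by (auto simp: halves_def)
    ultimately have "a = 1"
      using assms \<open>J' \<noteq> {}\<close> by (simp add: lookup_halving_form)
    obtain U where U: "U \<in> halves S J" "x \<notin> U"
      by (rule ex_halves_avoiding[of S t J x]) (use assms x in auto)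
    have U': "S - U \<in> halves S J'" "U \<subseteq> S"
      using halves_complement[of S U] U J' x assms by (auto simp: halves_def)
    have "Poly_Mapping.lookup (halving_form c S J) (halving_monom c S U)
        = a * Poly_Mapping.lookup (halving_form c S J') (halving_monom c S (S - U))"
      unfolding a halving_monom_complement[OF U'(2)] by (rule lookup_scale)
    then have "crossing_sign S U = (- crossing_sign S U :: 'a)"
      using assms U U' \<open>J' \<noteq> {}\<close> \<open>a = 1\<close> one
      by (simp add: lookup_halving_form crossing_sign_complement)
    then show False
      using crossing_sign_cases[where 'a = 'a, of S U] by auto
  qed
qed

section \<open>Linear relations between halving forms\<close>

lemma halving_term_complement:
  assumes "finite S" "card S = 2 * t" "T \<subseteq> S"
  shows "Poly_Mapping.single (halving_monom c S (S - T)) (crossing_sign S (S - T) :: 'a::real_normed_field)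
    = Poly_Mapping.single (halving_monom c S T) ((- 1) ^ t * crossing_sign S T)"
  using assms by (simp add: halving_monom_complement crossing_sign_complement)

lemma halving_form_split:
  assumes "finite S"
  shows "halving_form c S J = halving_form c S (insert x J) +
    (\<Sum>T\<in>{T \<in> halves S J. x \<notin> T}.
      Poly_Mapping.single (halving_monom c S T) (crossing_sign S T :: 'a::real_normed_field))"
proof -
  have "halves S J = {T \<in> halves S J. x \<in> T} \<union> {T \<in> halves S J. x \<notin> T}"
    by auto
  moreover have "{T \<in> halves S J. x \<in> T} = halves S (insert x J)"
    by (auto simp: halves_def)
  ultimately have "halves S (insert x J) \<union> {T \<in> halves S J. x \<notin> T} = halves S J"
    by simp
  moreover have "halves S (insert x J) \<inter> {T \<in> halves S J. x \<notin> T} = {}"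
    by (auto simp: halves_def)
  ultimately show ?thesis
    unfolding halving_form_def using assms
    by (metis (no_types, lifting) finite_Un finite_halves sum.union_disjoint)
qed

lemma scale_two: "Poly_Mapping.single 0 2 * f = f + f" for f :: "'a::real_normed_field lpoly"
  by (rule poly_mapping_eqI) (simp add: lookup_scale lookup_add)

text \<open>
  Complementation maps the halves without \<open>x\<close> onto those with \<open>x\<close>, and for even \<open>t\<close> it keeps
  the signed monomial.
\<close>

lemma halving_form_empty:
  assumes "finite S" "card S = 2 * t" "even t" "x \<in> S"
  shows "halving_form c S {} = Poly_Mapping.single 0 2 * (halving_form c S {x} :: 'a::real_normed_field lpoly)"
proof -
  have "(\<Sum>T\<in>{T \<in> halves S {}. x \<notin> T}. Poly_Mapping.single (halving_monom c S T) (crossing_sign S T :: 'a))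
      = halving_form c S {x}"
    unfolding halving_form_def
  proof (rule sum.reindex_bij_witness[where i = "\<lambda>T. S - T" and j = "\<lambda>T. S - T"])
    fix T assume T: "T \<in> {T \<in> halves S {}. x \<notin> T}"
    then show "S - T \<in> halves S {x}"
      using halves_complement[OF assms(1), of T] assms by (auto simp: halves_def)
    show "Poly_Mapping.single (halving_monom c S (S - T)) (crossing_sign S (S - T) :: 'a)
        = Poly_Mapping.single (halving_monom c S T) (crossing_sign S T)"
      using T assms by (subst halving_term_complement[OF assms(1,2)]) (auto simp: halves_def)
  next
    fix T assume "T \<in> halves S {x}"
    then show "S - T \<in> {T \<in> halves S {}. x \<notin> T}"
      using halves_complement[OF assms(1), of T] by (auto simp: halves_def)
  qed (auto simp: halves_def)
  then show ?thesis
    using halving_form_split[OF assms(1), of c "{}" x, where 'a = 'a] by (simp add: scale_two)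
qed

text \<open>
  Complementation exchanges the halves that contain \<open>x\<close> but not \<open>y\<close> with those that contain
  \<open>y\<close> but not \<open>x\<close>, and for odd \<open>t\<close> it reverses the sign. What is left are the halves that
  contain both, counted twice.
\<close>

lemma halving_form_add:
  assumes "finite S" "card S = 2 * t" "odd t" "x \<in> S" "y \<in> S"
  shows "halving_form c S {x} + halving_form c S {y}
    = Poly_Mapping.single 0 2 * (halving_form c S {x, y} :: 'a::real_normed_field lpoly)"
proof -
  let ?w = "\<lambda>T. Poly_Mapping.single (halving_monom c S T) (crossing_sign S T :: 'a)"
  have "(\<Sum>T\<in>{T \<in> halves S {x}. y \<notin> T}. ?w T) = (\<Sum>T\<in>{T \<in> halves S {y}. x \<notin> T}. - ?w T)"
  proof (rule sum.reindex_bij_witness[where i = "\<lambda>T. S - T" and j = "\<lambda>T. S - T"])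
    fix T assume T: "T \<in> {T \<in> halves S {x}. y \<notin> T}"
    then show "S - T \<in> {T \<in> halves S {y}. x \<notin> T}"
      using halves_complement[OF assms(1), of T] assms by (auto simp: halves_def)
    show "- ?w (S - T) = ?w T"
      using T assms by (subst halving_term_complement[OF assms(1,2)]) (auto simp: halves_def single_uminus)
  next
    fix T assume "T \<in> {T \<in> halves S {y}. x \<notin> T}"
    then show "S - T \<in> {T \<in> halves S {x}. y \<notin> T}"
      using halves_complement[OF assms(1), of T] assms by (auto simp: halves_def)
  qed (auto simp: halves_def)
  then show ?thesis
    using halving_form_split[OF assms(1), of c "{x}" y, where 'a = 'a]
      halving_form_split[OF assms(1), of c "{y}" x, where 'a = 'a]
    by (simp add: scale_two sum_negf insert_commute)
qed

section \<open>The quadratic equations as halving forms\<close>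

lemma minus_one_power_lpoly:
  "(- 1) ^ m = (Poly_Mapping.single 0 ((- 1) ^ m) :: 'a::real_normed_field lpoly)"
  by (cases "even m") (auto simp: single_uminus)

text \<open>
  Moving the indices \<open>I\<close> from \<open>k\<close> to \<open>j\<close> corresponds to the half \<open>T = (j - k) \<union> I\<close>. As
  \<open>r\<close> is half the difference of the cardinalities, \<open>j \<union> I\<close> and \<open>k - I\<close> are equally large. The
  sign of \<open>I\<close> is the product of the signs of \<open>T\<close> and \<open>j - k\<close>. Taking \<open>r = 1\<close> gives the usual
  polynomials and \<open>r = 2\<close> the Pluecker-like ones.
\<close>

lemma quadratic_sum_eq_halving_form:
  fixes j k :: "nat set"
  assumes "finite j" "finite k" "card k = card j + 2 * r"
  shows "(\<Sum>I\<in>{I. I \<subseteq> k - j \<and> card I = r}.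
            (- 1) ^ num_gt (sym_diff j k) I * lvar (j \<union> I) * lvar (k - I) :: 'a::real_normed_field lpoly)
    = Poly_Mapping.single 0 (crossing_sign (sym_diff j k) (j - k)) *
      halving_form (j \<inter> k) (sym_diff j k) (j - k)"
proof -
  define S J c where "S = sym_diff j k" and "J = j - k" and "c = j \<inter> k"
  have card_S: "card S = 2 * (card J + r)"
  proof -
    have "card (j - k) + card (j \<inter> k) = card j" "card (k - j) + card (j \<inter> k) = card k"
      using assms card_Diff_subset_Int[of j k] card_Diff_subset_Int[of k j]
        card_mono[of j "j \<inter> k"] card_mono[of k "j \<inter> k"] by (auto simp: Int_commute)
    moreover have "card S = card (j - k) + card (k - j)"
      unfolding S_def using assms by (intro card_Un_disjoint) auto
    ultimately show ?thesis
      using assms unfolding J_def by simp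
  qed
  have "(\<Sum>I\<in>{I. I \<subseteq> k - j \<and> card I = r}. (- 1) ^ num_gt S I * lvar (j \<union> I) * lvar (k - I) :: 'a lpoly)
      = (\<Sum>T\<in>halves S J. Poly_Mapping.single 0 (crossing_sign S J) *
          Poly_Mapping.single (halving_monom c S T) (crossing_sign S T))"
  proof (rule sum.reindex_bij_witness[where i = "\<lambda>T. T - J" and j = "\<lambda>I. J \<union> I"])
    fix I assume "I \<in> {I. I \<subseteq> k - j \<and> card I = r}"
    then have I: "I \<subseteq> k - j" "card I = r"
      by auto
    then have disj: "finite J" "finite I" "J \<inter> I = {}" "finite S"
      using assms finite_subset[of I k] by (auto simp: J_def S_def)
    show "(J \<union> I) - J = I"
      using disj by auto
    show "J \<union> I \<in> halves S J"
      using I card_S disj by (auto simp: halves_def card_Un_disjoint) (auto simp: S_def J_def)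
    have "crossing_sign S J * (crossing_sign S J * crossing_sign S I) = (crossing_sign S I :: 'a)"
      by (simp add: mult.assoc[symmetric])
    moreover have "c \<union> (J \<union> I) = j \<union> I" "c \<union> (S - (J \<union> I)) = k - I"
      using I by (auto simp: c_def S_def J_def)
    ultimately show "Poly_Mapping.single 0 (crossing_sign S J) *
        Poly_Mapping.single (halving_monom c S (J \<union> I)) (crossing_sign S (J \<union> I))
      = ((- 1) ^ num_gt S I * lvar (j \<union> I) * lvar (k - I) :: 'a lpoly)"
      using disj unfolding halving_monom_def lvar_def minus_one_power_lpoly
      by (simp add: mult_single crossing_sign_Un) (simp add: crossing_sign_def)
  next
    fix T assume "T \<in> halves S J"
    then have T: "J \<subseteq> T" "T \<subseteq> S" "card T = card J + r"
      using card_S by (auto simp: halves_def)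
    then show "J \<union> (T - J) = T"
      by auto
    show "T - J \<in> {I. I \<subseteq> k - j \<and> card I = r}"
      using T assms by (auto simp: S_def J_def card_Diff_subset)
  qed
  then show ?thesis
    unfolding halving_form_def sum_distrib_left S_def J_def c_def .
qed

lemma plucker_eq_halving_form:
  assumes "finite j" "finite k" "card k = card j + 2"
  shows "plucker j k = Poly_Mapping.single 0 (crossing_sign (sym_diff j k) (j - k)) *
    (halving_form (j \<inter> k) (sym_diff j k) (j - k) :: 'a::real_normed_field lpoly)"
proof -
  have "{I. I \<subseteq> k - j \<and> card I = 1} = (\<lambda>i. {i}) ` (k - j)"
    by (auto simp: card_1_singleton_iff)
  then show ?thesis
    unfolding plucker_def using quadratic_sum_eq_halving_form[of j k 1, where 'a = 'a] assms
    by (simp add: sum.reindex)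
qed

lemma plucker_like_eq_halving_form:
  assumes "j \<subseteq> {1..n}" "k \<subseteq> {1..n}" "card k = card j + 4"
  shows "plucker_like n j k = Poly_Mapping.single 0 (crossing_sign (sym_diff j k) (j - k)) *
    (halving_form (j \<inter> k) (sym_diff j k) (j - k) :: 'a::real_normed_field lpoly)"
proof -
  have "finite j" "finite k"
    using assms finite_subset[of _ "{1..n}"] by auto
  moreover have "{i \<in> multi_indices n 2. i \<subseteq> k - j} = {I. I \<subseteq> k - j \<and> card I = 2}"
    using assms by (auto simp: multi_indices_def)
  ultimately show ?thesis
    unfolding plucker_like_def using quadratic_sum_eq_halving_form[of j k 2, where 'a = 'a] assms
    by simp
qed

text \<open>The pair with core \<open>c\<close> and difference \<open>S\<close>.\<close>

text \<open>
  The pairs \<open>(j, k)\<close> with given intersection \<open>c\<close> and symmetric difference \<open>S\<close> are obtained by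
  choosing the part \<open>J\<close> of \<open>S\<close> that belongs to \<open>j\<close>.
\<close>

lemma core_pair:
  assumes "c \<inter> S = {}" "J \<subseteq> S"
  shows "(c \<union> J) \<inter> (c \<union> (S - J)) = c" "sym_diff (c \<union> J) (c \<union> (S - J)) = S"
    "(c \<union> J) - (c \<union> (S - J)) = J"
  using assms by auto

section \<open>Counting pairs of sets by intersection size\<close>

text \<open>
  Choose \<open>j\<close> in \<open>N\<close>, then the part of \<open>k\<close> inside \<open>j\<close>, then the part of \<open>k\<close> outside \<open>j\<close>.
  The product of the three binomial coefficients telescopes to the multinomial coefficient.
\<close>

lemma card_pairs_eq_multinomial:
  assumes "finite N" "card N = q + x + y + z"
  shows "card {(j, k). j \<subseteq> N \<and> card j = q + x \<and> k \<subseteq> N \<and> card k = q + y \<and> card (j \<inter> k) = q}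
    = multinomial (card N) [q, x, y, z]"
proof -
  have fin: "finite A" if "A \<subseteq> N" for A
    using assms that finite_subset by blast
  have second: "card {k. k \<subseteq> N \<and> card k = q + y \<and> card (j \<inter> k) = q}
      = ((q + x) choose q) * ((y + z) choose y)" if j: "j \<subseteq> N" "card j = q + x" for j
  proof -
    have "bij_betw (\<lambda>(u, v). u \<union> v) ({u. u \<subseteq> j \<and> card u = q} \<times> {v. v \<subseteq> N - j \<and> card v = y})
        {k. k \<subseteq> N \<and> card k = q + y \<and> card (j \<inter> k) = q}"
    proof (rule bij_betwI[where g = "\<lambda>k. (j \<inter> k, k - j)"])
      show "(\<lambda>(u, v). u \<union> v) \<in> {u. u \<subseteq> j \<and> card u = q} \<times> {v. v \<subseteq> N - j \<and> card v = y}
          \<rightarrow> {k. k \<subseteq> N \<and> card k = q + y \<and> card (j \<inter> k) = q}"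
      proof (clarsimp, intro conjI)
        fix u v assume uv: "u \<subseteq> j" "q = card u" "v \<subseteq> N - j" "y = card v"
        show "u \<subseteq> N" "v \<subseteq> N" using uv j by auto
        show "card (u \<union> v) = card u + card v"
          using uv j by (intro card_Un_disjoint fin) auto
        have "j \<inter> (u \<union> v) = u" using uv by auto
        then show "card (j \<inter> (u \<union> v)) = card u" by simp
      qed
      show "(\<lambda>k. (j \<inter> k, k - j)) \<in> {k. k \<subseteq> N \<and> card k = q + y \<and> card (j \<inter> k) = q}
          \<rightarrow> {u. u \<subseteq> j \<and> card u = q} \<times> {v. v \<subseteq> N - j \<and> card v = y}"
      proof (clarsimp, intro conjI)
        fix k assume k: "k \<subseteq> N" "card k = card (j \<inter> k) + y" "q = card (j \<inter> k)"
        show "k - j \<subseteq> N - j" using k by auto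
        show "card (k - j) = y"
          using k fin[of "k \<inter> j"] by (simp add: card_Diff_subset_Int Int_commute le_infI2)
      qed
    qed auto
    then have "card {k. k \<subseteq> N \<and> card k = q + y \<and> card (j \<inter> k) = q}
        = card ({u. u \<subseteq> j \<and> card u = q} \<times> {v. v \<subseteq> N - j \<and> card v = y})"
      by (rule bij_betw_same_card[symmetric])
    then show ?thesis
      using assms j fin[OF j(1)] by (simp add: card_cartesian_product n_subsets card_Diff_subset add.assoc)
  qed
  have "{(j, k). j \<subseteq> N \<and> card j = q + x \<and> k \<subseteq> N \<and> card k = q + y \<and> card (j \<inter> k) = q}
      = Sigma {j. j \<subseteq> N \<and> card j = q + x} (\<lambda>j. {k. k \<subseteq> N \<and> card k = q + y \<and> card (j \<inter> k) = q})"
    by auto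
  then have "card {(j, k). j \<subseteq> N \<and> card j = q + x \<and> k \<subseteq> N \<and> card k = q + y \<and> card (j \<inter> k) = q}
      = (card N choose (q + x)) * (((q + x) choose q) * ((y + z) choose y))"
    using assms by (simp add: card_SigmaI second n_subsets)
  moreover
  have "(card N choose (q + x)) * (((q + x) choose q) * ((y + z) choose y))
      * (fact q * fact x * fact y * fact z) = (fact (card N) :: nat)"
  proof -
    have "fact (q + x) * fact (y + z) * (card N choose (q + x)) = (fact (card N) :: nat)"
      using binomial_fact_lemma[of "q + x" "card N"] assms by (simp add: add.assoc)
    moreover have "fact q * fact x * ((q + x) choose q) = (fact (q + x) :: nat)"
      using binomial_fact_lemma[of q "q + x"] by simp
    moreover have "fact y * fact z * ((y + z) choose y) = (fact (y + z) :: nat)"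
      using binomial_fact_lemma[of y "y + z"] by simp
    moreover
  have "(card N choose (q + x)) * (((q + x) choose q) * ((y + z) choose y))
        * (fact q * fact x * fact y * fact z)
      = (fact q * fact x * ((q + x) choose q)) * (fact y * fact z * ((y + z) choose y))
        * (card N choose (q + x))"
      by (simp only: mult_ac)
    ultimately show ?thesis
      by simp
  qed
  then have "fact (card N) div (fact q * fact x * fact y * fact z)
      = (card N choose (q + x)) * (((q + x) choose q) * ((y + z) choose y))"
    by (metis fact_nonzero mult_eq_0_iff nonzero_mult_div_cancel_right)
  ultimately show ?thesis
    unfolding multinomial_def by (simp add: mult.assoc)
qed

section \<open>Normal forms and distinctness\<close>

text \<open>
  If \<open>j \<subseteq> k\<close>, then \<open>halving_form_empty\<close> replaces the empty set \<open>j - k\<close> by a singleton. This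
  makes the results on forms of nonempty sets available for all Pluecker-like polynomials.
\<close>

lemma plucker_like_normal_form:
  assumes "2 \<le> p" "j \<in> multi_indices n (p - 2)" "k \<in> multi_indices n (p + 2)"
  obtains a L where "a \<noteq> 0"
    "(plucker_like n j k :: 'a::real_normed_field lpoly)
      = Poly_Mapping.single 0 a * halving_form (j \<inter> k) (sym_diff j k) L"
    "L \<subseteq> sym_diff j k" "card L = max 1 (p - 2 - card (j \<inter> k))" "j - k \<noteq> {} \<longrightarrow> L = j - k"
    "card (sym_diff j k) = 2 * (p - card (j \<inter> k))" "card (j \<inter> k) \<le> p - 2"
proof -
  let ?c = "j \<inter> k" and ?S = "sym_diff j k"
  have jk: "j \<subseteq> {1..n}" "k \<subseteq> {1..n}" "card j = p - 2" "card k = p + 2"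
    using assms by (auto simp: multi_indices_def)
  then have fin: "finite j" "finite k"
    using finite_subset[of _ "{1..n}"] by auto
  have le: "card ?c \<le> p - 2"
    using fin jk card_mono[of j ?c] by auto
  have cards: "card (j - k) = p - 2 - card ?c" "card (k - j) = p + 2 - card ?c"
    using fin jk by (simp_all add: card_Diff_subset_Int Int_commute)
  have card_S: "card ?S = 2 * (p - card ?c)"
    using fin cards le assms by (subst card_Un_disjoint) auto
  have form: "(plucker_like n j k :: 'a lpoly)
      = Poly_Mapping.single 0 (crossing_sign ?S (j - k)) * halving_form ?c ?S (j - k)"
    using jk assms by (intro plucker_like_eq_halving_form) auto
  show ?thesis
  proof (cases "j - k = {}")
    case False
    then have "0 < card (j - k)"
      using fin by (simp add: card_gt_0_iff)
    then show ?thesis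
      using False cards card_S le form
      by (intro that[of "crossing_sign ?S (j - k)" "j - k"]) auto
  next
    case True
    then have "card (j - k) = 0"
      by (simp only: card.empty)
    then have c: "card ?c = p - 2"
      using cards(1) le by linarith
    then have card4: "card ?S = 2 * 2"
      using card_S assms by simp
    then obtain x where x: "x \<in> ?S"
      by (metis all_not_in_conv card.empty mult_eq_0_iff zero_neq_numeral)
    have "(plucker_like n j k :: 'a lpoly) = halving_form ?c ?S {}"
      using form unfolding True by simp
    also have "\<dots> = Poly_Mapping.single 0 2 * halving_form ?c ?S {x}"
      using fin card4 x by (intro halving_form_empty[of _ 2]) auto
    finally have "(plucker_like n j k :: 'a lpoly)
        = Poly_Mapping.single 0 2 * halving_form ?c ?S {x}" .
    moreover have "{x} \<subseteq> ?S" "card {x} = max 1 (p - 2 - card ?c)"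
      using x c by auto
    ultimately show ?thesis
      using True card_S le by (intro that[OF zero_neq_numeral[symmetric]]) blast+
  qed
qed

text \<open>
  Here half of the symmetric difference has \<open>t = p - card (j \<inter> k)\<close> elements. For \<open>j \<subseteq> k\<close> the
  symmetric difference has four elements and the normal form extends a singleton to a half of
  it, in three ways; otherwise two more elements are chosen from \<open>k - j\<close>.
\<close>

lemma num_terms_plucker_like:
  assumes "2 \<le> p" "j \<in> multi_indices n (p - 2)" "k \<in> multi_indices n (p + 2)"
  shows "num_terms (plucker_like n j k :: 'a::real_normed_field lpoly)
    = (if card (j \<inter> k) = p - 2 then 3 else (p + 2 - card (j \<inter> k)) choose 2)"
proof -
  obtain a :: 'a and L where nf: "a \<noteq> 0"
    "plucker_like n j k = Poly_Mapping.single 0 a * halving_form (j \<inter> k) (sym_diff j k) L"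
    "L \<subseteq> sym_diff j k" "card L = max 1 (p - 2 - card (j \<inter> k))" "j - k \<noteq> {} \<longrightarrow> L = j - k"
    "card (sym_diff j k) = 2 * (p - card (j \<inter> k))" "card (j \<inter> k) \<le> p - 2"
    by (rule plucker_like_normal_form[OF assms])
  have fin: "finite (sym_diff j k)"
    using nf(6,7) assms(1) by (intro card_ge_0_finite) linarith
  then have "num_terms (halving_form (j \<inter> k) (sym_diff j k) L :: 'a lpoly)
      = (2 * (p - card (j \<inter> k)) - card L) choose (p - card (j \<inter> k) - card L)"
    unfolding nf(6)[symmetric] using nf(3,4,6,7) fin assms(1) by (intro num_terms_halving_form) auto
  moreover have "num_terms (plucker_like n j k :: 'a lpoly)
      = num_terms (halving_form (j \<inter> k) (sym_diff j k) L :: 'a lpoly)"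
    unfolding nf(2) using nf(1) by (simp add: num_terms_def keys_scale)
  moreover have "2 * (p - card (j \<inter> k)) - card L = 3 \<and> p - card (j \<inter> k) - card L = 1"
    if "card (j \<inter> k) = p - 2"
    using that nf(4,7) assms(1) by auto
  moreover have "2 * (p - card (j \<inter> k)) - card L = p + 2 - card (j \<inter> k)
      \<and> p - card (j \<inter> k) - card L = 2"
    if "card (j \<inter> k) \<noteq> p - 2"
    using that nf(4,7) assms(1) by auto
  ultimately show ?thesis
    by auto
qed

text \<open>
  The normal forms give the intersection and the symmetric difference of \<open>j\<close> and \<open>k\<close>, so it
  remains to find \<open>j - k\<close>. It is empty if \<open>j \<inter> k\<close> has \<open>p - 2\<close> elements; otherwise the form
  determines it, since \<open>t = 3\<close> is odd in the only case where it is a singleton.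
\<close>

lemma same_eqn_plucker_likeD:
  assumes "2 \<le> p"
    and "j \<in> multi_indices n (p - 2)" "k \<in> multi_indices n (p + 2)"
    and "j' \<in> multi_indices n (p - 2)" "k' \<in> multi_indices n (p + 2)"
    and "same_eqn (plucker_like n j k :: 'a::real_normed_field lpoly) (plucker_like n j' k')"
  shows "j = j' \<and> k = k'"
proof -
  obtain a :: 'a and L where nf: "a \<noteq> 0"
    "plucker_like n j k = Poly_Mapping.single 0 a * halving_form (j \<inter> k) (sym_diff j k) L"
    "L \<subseteq> sym_diff j k" "card L = max 1 (p - 2 - card (j \<inter> k))" "j - k \<noteq> {} \<longrightarrow> L = j - k"
    "card (sym_diff j k) = 2 * (p - card (j \<inter> k))" "card (j \<inter> k) \<le> p - 2"
    by (rule plucker_like_normal_form[OF assms(1,2,3)])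
  obtain a' :: 'a and L' where nf': "a' \<noteq> 0"
    "plucker_like n j' k' = Poly_Mapping.single 0 a' * halving_form (j' \<inter> k') (sym_diff j' k') L'"
    "L' \<subseteq> sym_diff j' k'" "card L' = max 1 (p - 2 - card (j' \<inter> k'))" "j' - k' \<noteq> {} \<longrightarrow> L' = j' - k'"
    "card (sym_diff j' k') = 2 * (p - card (j' \<inter> k'))" "card (j' \<inter> k') \<le> p - 2"
    by (rule plucker_like_normal_form[OF assms(1,4,5)])
  have jk: "card j = p - 2" "card j' = p - 2" "finite j" "finite j'"
    using assms finite_subset[of _ "{1..n}"] by (auto simp: multi_indices_def)
  have fin: "finite (sym_diff j k)" "finite (sym_diff j' k')"
    using nf(6,7) nf'(6,7) assms(1) by (intro card_ge_0_finite; linarith)+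
  have ne: "L \<noteq> {}" "L' \<noteq> {}"
    using nf(4) nf'(4) by auto
  have same: "same_eqn (halving_form (j \<inter> k) (sym_diff j k) L :: 'a lpoly)
      (halving_form (j' \<inter> k') (sym_diff j' k') L')"
    using assms(6) unfolding nf(2) nf'(2) same_eqn_scale_iff[OF nf(1) nf'(1)] .
  have core: "j \<inter> k = j' \<inter> k'" and diff: "sym_diff j k = sym_diff j' k'"
    by (rule same_eqn_halving_formD[OF same fin(1) _ ne(1) nf(3,6) _ fin(2) _ ne(2)];
        use nf(4,7) assms(1) in auto)+
  have "j - k = j' - k'"
  proof (cases "card (j \<inter> k) = p - 2")
    case True
    then have "j \<inter> k = j" "j' \<inter> k' = j'"
      using jk core card_subset_eq[of j "j \<inter> k"] card_subset_eq[of j' "j' \<inter> k'"] by auto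
    then show ?thesis
      by auto
  next
    case False
    then have "j - k \<noteq> {}" "j' - k' \<noteq> {}"
      using jk core by (metis Diff_eq_empty_iff inf.absorb_iff1)+
    then have L: "L = j - k" "L' = j' - k'"
      using nf(5) nf'(5) by auto
    have "L = L'"
    proof (rule same_eqn_halving_form_inject[where t = "p - card (j \<inter> k)"])
      show "same_eqn (halving_form (j \<inter> k) (sym_diff j k) L :: 'a lpoly)
          (halving_form (j \<inter> k) (sym_diff j k) L')"
        using same core diff by simp
      have "odd (p - card (j \<inter> k))" if "card L = 1"
      proof -
        have three: "p - card (j \<inter> k) = 3"
          using that nf(4,7) False assms(1) by auto
        show ?thesis
          unfolding three by simp
      qed
      moreover have "card L = 1 \<or> 2 \<le> card L"
        using nf(4) by linarith
      ultimately show "2 \<le> card L \<or> odd (p - card (j \<inter> k))"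
        by blast
      show "L' \<subseteq> sym_diff j k" "card L' = card L"
        using nf'(3) nf(4) nf'(4) core diff by auto
      show "card L < p - card (j \<inter> k)"
        using nf(4,7) assms(1) by auto
    qed (use nf(3,6) fin ne in auto)
    then show ?thesis
      using L by simp
  qed
  then show ?thesis
    using core diff by blast
qed

section \<open>The usual equations among the combinations\<close>

lemma plucker_core_pair:
  assumes "finite c" "finite S" "c \<inter> S = {}" "J \<subseteq> S" "card S = 2 * card J + 2"
  shows "plucker (c \<union> J) (c \<union> (S - J))
    = Poly_Mapping.single 0 (crossing_sign S J) * (halving_form c S J :: 'a::real_normed_field lpoly)"
proof -
  have "finite J"
    using assms finite_subset by blast
  moreover have "c \<inter> J = {}" "c \<inter> (S - J) = {}"
    using assms by auto
  ultimately have "card (c \<union> (S - J)) = card (c \<union> J) + 2"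
    using assms by (simp add: card_Un_disjoint card_Diff_subset)
  then show ?thesis
    using plucker_eq_halving_form[of "c \<union> J" "c \<union> (S - J)", where 'a = 'a]
      core_pair[OF assms(3,4)] assms \<open>finite J\<close> by simp
qed

lemma plucker_in_plucker_eqs:
  assumes "c \<union> S \<subseteq> {1..n}" "c \<inter> S = {}" "J \<subseteq> S" "card S = 2 * card J + 2" "card c + card J + 1 = p"
  shows "plucker (c \<union> J) (c \<union> (S - J)) \<in> (plucker_eqs n p :: 'a::real_normed_field lpoly set)"
proof -
  have fin: "finite c" "finite S" "finite J"
    using assms finite_subset[of _ "{1..n}"] finite_subset[of J S] by auto
  moreover have "c \<inter> J = {}" "c \<inter> (S - J) = {}"
    using assms by auto
  ultimately have "card (c \<union> J) = p - 1" "card (c \<union> (S - J)) = p + 1"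
    using assms by (auto simp: card_Un_disjoint card_Diff_subset)
  then show ?thesis
    unfolding plucker_eqs_def multi_indices_def using assms by blast
qed

text \<open>
  The normal form is \<open>halving_form c S {x}\<close> with a set \<open>S\<close> of four elements, and
  a singleton is one element short of half of \<open>S\<close>, as in a usual equation.
\<close>

lemma plucker_like_subset_is_plucker:
  assumes "2 \<le> p" "j \<in> multi_indices n (p - 2)" "k \<in> multi_indices n (p + 2)" "card (j \<inter> k) = p - 2"
  shows "gives_eqn_of (plucker_like n j k :: 'a::real_normed_field lpoly) (plucker_eqs n p)"
proof -
  let ?c = "j \<inter> k" and ?S = "sym_diff j k"
  obtain a :: 'a and L where nf: "a \<noteq> 0"
    "plucker_like n j k = Poly_Mapping.single 0 a * halving_form ?c ?S L"
    "L \<subseteq> ?S" "card L = max 1 (p - 2 - card ?c)" "j - k \<noteq> {} \<longrightarrow> L = j - k"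
    "card ?S = 2 * (p - card ?c)" "card ?c \<le> p - 2"
    by (rule plucker_like_normal_form[OF assms(1,2,3)])
  have sub: "?c \<union> ?S \<subseteq> {1..n}"
    using assms by (auto simp: multi_indices_def)
  have cards: "card L = 1" "card ?S = 4"
    using nf(4,6) assms(1,4) by auto
  have fin: "finite ?c" "finite ?S"
    using sub finite_subset[of _ "{1..n}"] by blast+
  have disj: "?c \<inter> ?S = {}"
    by auto
  have "plucker (?c \<union> L) (?c \<union> (?S - L)) \<in> (plucker_eqs n p :: 'a lpoly set)"
    using sub disj nf(3) cards assms by (intro plucker_in_plucker_eqs) auto
  moreover have "plucker (?c \<union> L) (?c \<union> (?S - L))
      = Poly_Mapping.single 0 (crossing_sign ?S L) * (halving_form ?c ?S L :: 'a lpoly)"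
    using fin disj nf(3) cards by (intro plucker_core_pair) auto
  moreover have "same_eqn (halving_form ?c ?S L :: 'a lpoly) (halving_form ?c ?S L)"
    by (rule same_eqn_refl)
  ultimately show ?thesis
    unfolding gives_eqn_of_def nf(2) using nf(1)
    by (metis same_eqn_scale_iff crossing_sign_nonzero)
qed

lemma core_pair_multi_indices:
  assumes "c \<union> S \<subseteq> {1..n}" "c \<inter> S = {}" "s \<in> S" "card c + 3 = p" "card S = 6"
  shows "c \<union> {s} \<in> multi_indices n (p - 2)" "c \<union> (S - {s}) \<in> multi_indices n (p + 2)"
proof -
  have fin: "finite c" "finite S"
    using assms finite_subset[of _ "{1..n}"] by auto
  have disj: "c \<inter> {s} = {}" "c \<inter> (S - {s}) = {}"
    using assms by auto
  show "c \<union> {s} \<in> multi_indices n (p - 2)"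
    unfolding multi_indices_def using assms fin disj by (auto simp: card_Un_disjoint simp del: Un_insert_right)
  show "c \<union> (S - {s}) \<in> multi_indices n (p + 2)"
    unfolding multi_indices_def using assms fin disj by (auto simp: card_Un_disjoint)
qed

text \<open>
  The equations with \<open>j \<inter> k = c\<close>, with symmetric difference \<open>S\<close> and with only one index in
  \<open>j - k\<close>. If \<open>S\<close> has six elements, these are the sets of equations
  with the same terms.
\<close>

definition six_family :: "nat \<Rightarrow> nat set \<Rightarrow> nat set \<Rightarrow> 'a::real_normed_field lpoly set" where
  "six_family n c S = (\<lambda>s. plucker_like n (c \<union> {s}) (c \<union> (S - {s}))) ` S"

lemma plucker_like_core_pair:
  assumes "c \<union> S \<subseteq> {1..n}" "c \<inter> S = {}" "s \<in> S" "card S = 6"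
  shows "plucker_like n (c \<union> {s}) (c \<union> (S - {s}))
    = Poly_Mapping.single 0 (crossing_sign S {s}) * (halving_form c S {s} :: 'a::real_normed_field lpoly)"
proof -
  have fin: "finite c" "finite S"
    using assms finite_subset[of _ "{1..n}"] by auto
  have disj: "c \<inter> {s} = {}" "c \<inter> (S - {s}) = {}"
    using assms by auto
  have "{s} \<subseteq> S"
    using assms by auto
  note core = core_pair[OF assms(2) this]
  have "card (c \<union> (S - {s})) = card (c \<union> {s}) + 4"
    using assms fin disj by (simp add: card_Un_disjoint del: Un_insert_right)
  then show ?thesis
    using plucker_like_eq_halving_form[of "c \<union> {s}" n "c \<union> (S - {s})", where 'a = 'a]
    unfolding core(2) unfolding core(1,3) using assms(1,3) by blast
qed

lemma inj_on_six_family: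
  assumes "c \<union> S \<subseteq> {1..n}" "c \<inter> S = {}" "card c + 3 = p" "card S = 6"
  shows "inj_on (\<lambda>s. plucker_like n (c \<union> {s}) (c \<union> (S - {s})) :: 'a::real_normed_field lpoly) S"
proof (rule inj_onI)
  fix s t assume st: "s \<in> S" "t \<in> S"
    and eq: "(plucker_like n (c \<union> {s}) (c \<union> (S - {s})) :: 'a lpoly)
      = plucker_like n (c \<union> {t}) (c \<union> (S - {t}))"
  have "same_eqn (plucker_like n (c \<union> {s}) (c \<union> (S - {s})) :: 'a lpoly)
      (plucker_like n (c \<union> {t}) (c \<union> (S - {t})))"
    unfolding eq by (rule same_eqn_refl)
  moreover have "2 \<le> p"
    using assms(3) by simp
  ultimately have "c \<union> {s} = c \<union> {t}"
    using same_eqn_plucker_likeD[OF _ core_pair_multi_indices[OF assms(1,2) st(1) assms(3,4)]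
      core_pair_multi_indices[OF assms(1,2) st(2) assms(3,4)]] by blast
  then show "s = t"
    using assms st by auto
qed

text \<open>
  For every \<open>s\<close> in \<open>S\<close>, each splitting of \<open>S\<close> into two triples has exactly one triple that
  contains \<open>s\<close>. So all members have one monomial for each splitting, with coefficient
  \<open>1\<close> or \<open>- 1\<close>.
\<close>

lemma same_terms_six_family:
  assumes "c \<union> S \<subseteq> {1..n}" "c \<inter> S = {}" "card S = 6"
    and "f \<in> six_family n c S" "g \<in> six_family n c S"
  shows "same_terms f (g :: 'a::real_normed_field lpoly)"
proof -
  have fin: "finite S"
    using assms finite_subset[of _ "{1..n}"] by auto
  have coeff: "Poly_Mapping.lookup h m
      \<in> (if m \<in> halving_monom c S ` halves S {} then {1, - 1} else {0})"
    if h: "h \<in> six_family n c S" for h :: "'a lpoly" and m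
  proof -
    obtain s where s: "s \<in> S"
      "h = Poly_Mapping.single 0 (crossing_sign S {s}) * halving_form c S {s}"
      using h plucker_like_core_pair[OF assms(1,2) _ assms(3), where 'a = 'a]
      unfolding six_family_def by blast
    have keys: "Poly_Mapping.keys (halving_form c S {s} :: 'a lpoly) = halving_monom c S ` halves S {s}"
      using fin assms by (intro keys_halving_form) auto
    have image: "halving_monom c S ` halves S {s} = halving_monom c S ` halves S {}"
    proof
      show "halving_monom c S ` halves S {s} \<subseteq> halving_monom c S ` halves S {}"
        by (auto simp: halves_def)
      show "halving_monom c S ` halves S {} \<subseteq> halving_monom c S ` halves S {s}"
      proof (rule image_subsetI)
        fix T assume T: "T \<in> halves S {}"
        then have "T \<subseteq> S" by (auto simp: halves_def)
        show "halving_monom c S T \<in> halving_monom c S ` halves S {s}"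
        proof (cases "s \<in> T")
          case True
          then show ?thesis using T by (auto simp: halves_def)
        next
          case False
          then have "S - T \<in> halves S {s}"
            using halves_complement[OF fin T] s by (auto simp: halves_def)
          then show ?thesis
            using halving_monom_complement[OF \<open>T \<subseteq> S\<close>, of c] by (metis imageI)
        qed
      qed
    qed
    show ?thesis
    proof (cases "m \<in> halving_monom c S ` halves S {s}")
      case True
      then obtain T where T: "T \<in> halves S {s}" "m = halving_monom c S T"
        by auto
      then have "Poly_Mapping.lookup h m = crossing_sign S {s} * crossing_sign S T"
        using s fin assms by (simp add: lookup_scale lookup_halving_form)
      then show ?thesis
        using True image crossing_sign_cases[where 'a = 'a, of S T]
          crossing_sign_cases[where 'a = 'a, of S "{s}"] by auto
    next
      case False
      then have "Poly_Mapping.lookup (halving_form c S {s} :: 'a lpoly) m = 0"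
        unfolding keys[symmetric] by (simp add: in_keys_iff)
      then show ?thesis
        using False image s by (auto simp: lookup_scale)
    qed
  qed
  show ?thesis
    unfolding same_terms_def
  proof
    fix m
    show "Poly_Mapping.lookup f m = Poly_Mapping.lookup g m
        \<or> Poly_Mapping.lookup f m = - Poly_Mapping.lookup g m"
      using coeff[OF assms(4), of m] coeff[OF assms(5), of m] by (auto split: if_splits)
  qed
qed

text \<open>
  In increasing order \<open>e 1 < \<dots> < e 6\<close> of \<open>S\<close>, there are \<open>6 - i\<close> elements above \<open>e i\<close>, so the
  equation of \<open>e i\<close> is \<open>(-1)^i\<close> times the form of \<open>{e i}\<close>. Hence \<open>E i + (-1)^(i + i') E i'\<close>
  is \<open>(-1)^i\<close> times the sum of the forms of \<open>{e i}\<close> and \<open>{e i'}\<close>, which is twice the form of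
  \<open>{e i, e i'}\<close>. That set is one element short of half of \<open>S\<close>, so its form is a usual equation;
  there are fifteen such sets, each contained in four triples.
\<close>

lemma six_family_combinations:
  assumes "c \<union> S \<subseteq> {1..n}" "c \<inter> S = {}" "card c + 3 = p" "card S = 6"
  shows "\<exists>E. bij_betw E {1..6::nat} (six_family n c S) \<and>
    (\<exists>W \<subseteq> (plucker_eqs n p :: 'a::real_normed_field lpoly set).
      card W = 15 \<and>
      (\<forall>f\<in>W. \<forall>g\<in>W. f \<noteq> g \<longrightarrow> \<not> same_eqn f g) \<and>
      (\<forall>f\<in>W. num_terms f = 4) \<and>
      (\<forall>i i'. 1 \<le> i \<and> i < i' \<and> i' \<le> 6 \<longrightarrow> gives_eqn_of (E i + (- 1) ^ (i + i') * E i') W))"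
proof -
  have fin: "finite c" "finite S"
    using assms finite_subset[of _ "{1..n}"] by auto
  let ?P = "\<lambda>J. plucker (c \<union> J) (c \<union> (S - J)) :: 'a lpoly"
  let ?D = "{J. J \<subseteq> S \<and> card J = 2}"
  let ?Q = "\<lambda>s. plucker_like n (c \<union> {s}) (c \<union> (S - {s})) :: 'a lpoly"
  have P: "?P J = Poly_Mapping.single 0 (crossing_sign S J) * halving_form c S J" if "J \<in> ?D" for J
    using that assms fin by (intro plucker_core_pair) auto
  have P_inj: "J = J'" if "same_eqn (?P J) (?P J')" "J \<in> ?D" "J' \<in> ?D" for J J'
  proof (rule same_eqn_halving_form_inject[where t = 3])
    show "same_eqn (halving_form c S J :: 'a lpoly) (halving_form c S J')"
      using that by (simp add: P same_eqn_scale_iff)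
  qed (use that fin assms in auto)
  \<comment> \<open>The element with \<open>6 - i\<close> elements above it: \<open>e\<close> enumerates \<open>S\<close> increasingly.\<close>
  define e where "e i = the_inv_into S (\<lambda>s. num_gt S {s}) (6 - i)" for i
  have rank: "bij_betw (\<lambda>s. num_gt S {s}) S {..<6}"
    using bij_betw_num_gt_singleton[OF fin(2)] assms by simp
  have "bij_betw (\<lambda>i::nat. 6 - i) {1..6} {..<6}"
    by (rule bij_betwI[where g = "\<lambda>i. 6 - i"]) auto
  from bij_betw_trans[OF this bij_betw_the_inv_into[OF rank]]
  have e: "bij_betw e {1..6} S"
    unfolding e_def comp_def .
  have e_in: "e i \<in> S" if "i \<in> {1..6}" for i
    using bij_betwE[OF e] that by auto
  have sign: "crossing_sign S {e i} = ((- 1) ^ i :: 'a)" if "i \<in> {1..6}" for i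
  proof -
    have "num_gt S {e i} = 6 - i"
      unfolding e_def using that rank by (intro f_the_inv_into_f) (auto simp: bij_betw_def)
    moreover have "(- 1) ^ (6 - i) * (- 1) ^ i = (1 :: 'a)"
      using that by (simp flip: power_add)
    ultimately show ?thesis
      unfolding crossing_sign_def by (metis left_minus_one_mult_self mult.commute mult.left_neutral mult.assoc)
  qed
  have Q: "bij_betw ?Q S (six_family n c S)"
    using inj_on_six_family[OF assms, where 'a = 'a] by (simp add: bij_betw_def six_family_def)
  have "gives_eqn_of (?Q (e i) + (- 1) ^ (i + i') * ?Q (e i')) (?P ` ?D)"
    if i: "1 \<le> i" "i < i'" "i' \<le> 6" for i i'
  proof -
    have ii: "i \<in> {1..6}" "i' \<in> {1..6}"
      using i by auto
    let ?J = "{e i, e i'}"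
    have "e i \<noteq> e i'"
      using e i ii by (auto simp: bij_betw_def dest: inj_onD)
    then have D: "?J \<in> ?D"
      using e_in ii by auto
    have "?Q (e i) + (- 1) ^ (i + i') * ?Q (e i')
        = Poly_Mapping.single 0 ((- 1) ^ i) * (halving_form c S {e i} + halving_form c S {e i'})"
    proof -
      have Q_e: "?Q (e l) = Poly_Mapping.single 0 ((- 1) ^ l) * halving_form c S {e l}"
        if "l \<in> {1..6}" for l
        using plucker_like_core_pair[OF assms(1,2) e_in[OF that] assms(4), where 'a = 'a]
        unfolding sign[OF that] .
      have "(- 1) ^ (i + i') * (- 1) ^ i' = ((- 1) ^ i :: 'a)"
        by (simp add: power_add mult.assoc)
      then show ?thesis
        unfolding Q_e[OF ii(1)] Q_e[OF ii(2)] minus_one_power_lpoly scale_scale distrib_left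
        by simp
    qed
    also have "\<dots> = Poly_Mapping.single 0 ((- 1) ^ i * 2) * halving_form c S ?J"
    proof -
      have "halving_form c S {e i} + halving_form c S {e i'}
          = Poly_Mapping.single 0 2 * (halving_form c S ?J :: 'a lpoly)"
        using e_in ii assms fin by (intro halving_form_add[of S 3]) auto
      then show ?thesis
        unfolding scale_scale[symmetric] by (rule arg_cong)
    qed
    finally have eq: "?Q (e i) + (- 1) ^ (i + i') * ?Q (e i')
      = Poly_Mapping.single 0 ((- 1) ^ i * 2) * halving_form c S ?J" .
    have "same_eqn (?Q (e i) + (- 1) ^ (i + i') * ?Q (e i')) (?P ?J)"
      unfolding eq P[OF D] by (intro same_eqn_scale_iff[THEN iffD2] same_eqn_refl) auto
    then show ?thesis
      unfolding gives_eqn_of_def by (rule bexI) (rule imageI[OF D])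
  qed
  then have combinations: "\<forall>i i'. 1 \<le> i \<and> i < i' \<and> i' \<le> 6 \<longrightarrow>
      gives_eqn_of ((?Q \<circ> e) i + (- 1) ^ (i + i') * (?Q \<circ> e) i') (?P ` ?D)"
    unfolding comp_def by blast
  have sub: "?P ` ?D \<subseteq> plucker_eqs n p"
  proof (rule image_subsetI)
    fix J assume "J \<in> ?D"
    then show "?P J \<in> plucker_eqs n p"
      using assms by (intro plucker_in_plucker_eqs) auto
  qed
  have card: "card (?P ` ?D) = 15"
  proof -
    have "inj_on ?P ?D"
    proof (rule inj_onI)
      fix J J' assume J: "J \<in> ?D" "J' \<in> ?D" and eq: "?P J = ?P J'"
      have "same_eqn (?P J) (?P J')"
        unfolding eq by (rule same_eqn_refl)
      then show "J = J'"
        using J by (rule P_inj)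
    qed
    moreover have "card ?D = 15"
      using assms fin by (simp add: n_subsets choose_two)
    ultimately show ?thesis
      by (simp add: card_image)
  qed
  have distinct: "\<forall>f\<in>?P ` ?D. \<forall>g\<in>?P ` ?D. f \<noteq> g \<longrightarrow> \<not> same_eqn f g"
  proof (intro ballI impI)
    fix f g assume fg: "f \<in> ?P ` ?D" "g \<in> ?P ` ?D" "f \<noteq> g"
    from fg(1) obtain J where J: "J \<in> ?D" "f = ?P J" by (rule imageE)
    from fg(2) obtain J' where J': "J' \<in> ?D" "g = ?P J'" by (rule imageE)
    show "\<not> same_eqn f g"
      using P_inj[OF _ J(1) J'(1)] J(2) J'(2) fg(3) by metis
  qed
  have terms: "\<forall>f\<in>?P ` ?D. num_terms f = 4"
  proof
    fix f assume "f \<in> ?P ` ?D"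
    then obtain J where J: "J \<in> ?D" "f = ?P J" by (rule imageE)
    have "num_terms (halving_form c S J :: 'a lpoly) = (card S - card J) choose (3 - card J)"
      using J(1) assms fin by (intro num_terms_halving_form) auto
    also have "\<dots> = 4"
      using J(1) assms by simp
    finally show "num_terms f = 4"
      unfolding J(2) P[OF J(1)] num_terms_def by (simp add: keys_scale)
  qed
  show ?thesis
    by (rule exI[of _ "?Q \<circ> e"], rule conjI[OF bij_betw_trans[OF e Q]], rule exI[of _ "?P ` ?D"])
      (intro conjI sub card distinct terms combinations)
qed

section \<open>Counting and partitioning the equations\<close>

definition overlap_pairs :: "nat \<Rightarrow> nat \<Rightarrow> nat \<Rightarrow> (nat set \<times> nat set) set" where
  "overlap_pairs n p q =
     {(j, k). j \<in> multi_indices n (p - 2) \<and> k \<in> multi_indices n (p + 2) \<and> card (j \<inter> k) = q}"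

definition overlap_eqs :: "nat \<Rightarrow> nat \<Rightarrow> nat \<Rightarrow> 'a::real_normed_field lpoly set" where
  "overlap_eqs n p q = (\<lambda>(j, k). plucker_like n j k) ` overlap_pairs n p q"

text \<open>
  The pairs \<open>(c, S)\<close> that index the six-element families. Writing \<open>card c + 3 = p\<close> avoids
  truncated subtraction.
\<close>

definition cores :: "nat \<Rightarrow> nat \<Rightarrow> (nat set \<times> nat set) set" where
  "cores n p = {(c, S). c \<union> S \<subseteq> {1..n} \<and> c \<inter> S = {} \<and> card c + 3 = p \<and> card S = 6}"

lemma overlap_pairs_bounds:
  assumes "2 \<le> p" "(j, k) \<in> overlap_pairs n p q"
  shows "q \<le> p - 2" "2 * p \<le> n + q"
proof -
  have jk: "j \<subseteq> {1..n}" "k \<subseteq> {1..n}" "card j = p - 2" "card k = p + 2" "card (j \<inter> k) = q"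
    using assms by (auto simp: overlap_pairs_def multi_indices_def)
  then have fin: "finite j" "finite k"
    using finite_subset[of _ "{1..n}"] by auto
  show "q \<le> p - 2"
    using fin jk card_mono[of j "j \<inter> k"] by auto
  have "card (j \<union> k) \<le> n"
    using jk card_mono[of "{1..n}" "j \<union> k"] by auto
  moreover have "card j + card k = card (j \<union> k) + card (j \<inter> k)"
    using fin by (rule card_Un_Int)
  ultimately show "2 * p \<le> n + q"
    using jk assms(1) by linarith
qed

lemma card_overlap_eqs:
  assumes "2 \<le> p" "q \<le> p - 2" "2 * p \<le> n + q"
  shows "card (overlap_eqs n p q :: 'a::real_normed_field lpoly set)
    = multinomial n [q, p - 2 - q, p + 2 - q, n + q - 2 * p]"
proof -
  have "inj_on (\<lambda>(j, k). plucker_like n j k :: 'a lpoly) (overlap_pairs n p q)"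
  proof (rule inj_onI, clarify)
    fix j k j' k'
    assume *: "(j, k) \<in> overlap_pairs n p q" "(j', k') \<in> overlap_pairs n p q"
      and eq: "(plucker_like n j k :: 'a lpoly) = plucker_like n j' k'"
    have "same_eqn (plucker_like n j k :: 'a lpoly) (plucker_like n j' k')"
      unfolding eq by (rule same_eqn_refl)
    then show "j = j' \<and> k = k'"
      using * assms(1) by (intro same_eqn_plucker_likeD) (auto simp: overlap_pairs_def)
  qed
  then have "card (overlap_eqs n p q :: 'a lpoly set) = card (overlap_pairs n p q)"
    unfolding overlap_eqs_def by (rule card_image)
  also have "overlap_pairs n p q = {(j, k). j \<subseteq> {1..n} \<and> card j = q + (p - 2 - q)
      \<and> k \<subseteq> {1..n} \<and> card k = q + (p + 2 - q) \<and> card (j \<inter> k) = q}"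
    using assms by (auto simp: overlap_pairs_def multi_indices_def)
  also have "card \<dots> = multinomial (card {1..n}) [q, p - 2 - q, p + 2 - q, n + q - 2 * p]"
    using assms by (intro card_pairs_eq_multinomial) auto
  finally show ?thesis
    by simp
qed

lemma overlap_eqs_disjoint:
  assumes "2 \<le> p" "q \<noteq> q'"
  shows "overlap_eqs n p q \<inter> (overlap_eqs n p q' :: 'a::real_normed_field lpoly set) = {}"
proof (rule ccontr)
  assume "overlap_eqs n p q \<inter> (overlap_eqs n p q' :: 'a lpoly set) \<noteq> {}"
  then obtain j k j' k' where *: "(j, k) \<in> overlap_pairs n p q" "(j', k') \<in> overlap_pairs n p q'"
    and eq: "(plucker_like n j k :: 'a lpoly) = plucker_like n j' k'"
    unfolding overlap_eqs_def by fastforce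
  have "same_eqn (plucker_like n j k :: 'a lpoly) (plucker_like n j' k')"
    unfolding eq by (rule same_eqn_refl)
  then have "j = j' \<and> k = k'"
    using * assms(1) by (intro same_eqn_plucker_likeD) (auto simp: overlap_pairs_def)
  then show False
    using * assms(2) by (auto simp: overlap_pairs_def)
qed

lemma num_terms_overlap_eqs:
  assumes "2 \<le> p" "f \<in> overlap_eqs n p q"
  shows "num_terms (f :: 'a::real_normed_field lpoly) = (if q = p - 2 then 3 else (p + 2 - q) choose 2)"
proof -
  obtain j k where "(j, k) \<in> overlap_pairs n p q" "f = plucker_like n j k"
    using assms(2) by (auto simp: overlap_eqs_def)
  then show ?thesis
    using num_terms_plucker_like[OF assms(1), of j n k, where 'a = 'a] by (simp add: overlap_pairs_def)
qed

lemma plucker_like_eqs_eq_Union: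
  "plucker_like_eqs n p = (\<Union>q. overlap_eqs n p q)"
  unfolding plucker_like_eqs_def overlap_eqs_def overlap_pairs_def by fastforce

lemma six_family_eqD:
  assumes "(c, S) \<in> cores n p" "(c', S') \<in> cores n p"
    and "f \<in> six_family n c S" "(f :: 'a::real_normed_field lpoly) \<in> six_family n c' S'"
  shows "c = c' \<and> S = S'"
proof -
  have cS: "c \<union> S \<subseteq> {1..n}" "c \<inter> S = {}" "card c + 3 = p" "card S = 6"
    and cS': "c' \<union> S' \<subseteq> {1..n}" "c' \<inter> S' = {}" "card c' + 3 = p" "card S' = 6"
    using assms(1,2) by (simp_all add: cores_def)
  obtain s where s: "s \<in> S" "f = plucker_like n (c \<union> {s}) (c \<union> (S - {s}))"
    using assms(3) unfolding six_family_def by (rule imageE)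
  obtain s' where s': "s' \<in> S'" "f = plucker_like n (c' \<union> {s'}) (c' \<union> (S' - {s'}))"
    using assms(4) unfolding six_family_def by (rule imageE)
  have "same_eqn f f"
    by (rule same_eqn_refl)
  moreover have "2 \<le> p"
    using cS by simp
  ultimately have eq: "c \<union> {s} = c' \<union> {s'}" "c \<union> (S - {s}) = c' \<union> (S' - {s'})"
    using same_eqn_plucker_likeD[OF _ core_pair_multi_indices[OF cS(1,2) s(1) cS(3,4)]
      core_pair_multi_indices[OF cS'(1,2) s'(1) cS'(3,4)], where 'a = 'a] s(2) s'(2) by metis+
  have sub: "{s} \<subseteq> S" "{s'} \<subseteq> S'"
    using s(1) s'(1) by auto
  show ?thesis
    using core_pair(1,2)[OF cS(2) sub(1)] core_pair(1,2)[OF cS'(2) sub(2)] unfolding eq by metis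
qed

text \<open>
  For \<open>card (j \<inter> k) = p - 3\<close>, one index lies in \<open>j - k\<close> and five lie in \<open>k - j\<close>.
\<close>

lemma overlap_eqs_eq_Union_six_family:
  assumes "3 \<le> p"
  shows "overlap_eqs n p (p - 3)
    = (\<Union>(c, S)\<in>cores n p. six_family n c S :: 'a::real_normed_field lpoly set)"
proof (intro equalityI subsetI)
  fix f assume "f \<in> (overlap_eqs n p (p - 3) :: 'a lpoly set)"
  then obtain j k where f: "f = plucker_like n j k"
    and jk: "j \<subseteq> {1..n}" "k \<subseteq> {1..n}" "card j = p - 2" "card k = p + 2" "card (j \<inter> k) = p - 3"
    by (auto simp: overlap_eqs_def overlap_pairs_def multi_indices_def)
  then have fin: "finite j" "finite k"
    using finite_subset[of _ "{1..n}"] by auto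
  have cards: "card (j - k) = 1" "card (k - j) = 5"
    using jk fin assms by (simp_all add: card_Diff_subset_Int Int_commute)
  then obtain s where s: "j - k = {s}"
    by (auto simp: card_1_singleton_iff)
  define c S where "c = j \<inter> k" and "S = insert s (k - j)"
  have "s \<notin> k - j"
    using s by auto
  then have "card S = 6"
    unfolding S_def using cards fin by simp
  moreover have "c \<inter> S = {}" "c \<union> S \<subseteq> {1..n}"
    using s jk unfolding c_def S_def by auto
  ultimately have "(c, S) \<in> cores n p"
    unfolding cores_def using jk assms by (simp add: c_def)
  moreover have "f \<in> six_family n c S"
  proof -
    have "c \<union> {s} = j" "c \<union> (S - {s}) = k"
      using s unfolding c_def S_def by auto
    then show ?thesis
      unfolding six_family_def f by (intro image_eqI[of _ _ s]) (simp_all only: S_def insertI1)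
  qed
  ultimately show "f \<in> (\<Union>(c, S)\<in>cores n p. six_family n c S)"
    by blast
next
  fix f assume "f \<in> (\<Union>(c, S)\<in>cores n p. six_family n c S :: 'a lpoly set)"
  then obtain c S where "(c, S) \<in> cores n p" and f: "f \<in> six_family n c S"
    by blast
  then have cS: "c \<union> S \<subseteq> {1..n}" "c \<inter> S = {}" "card c + 3 = p" "card S = 6"
    by (simp_all add: cores_def)
  obtain s where s: "s \<in> S" "f = plucker_like n (c \<union> {s}) (c \<union> (S - {s}))"
    using f unfolding six_family_def by (rule imageE)
  have "{s} \<subseteq> S"
    using s by simp
  from core_pair(1)[OF cS(2) this]
  have "card ((c \<union> {s}) \<inter> (c \<union> (S - {s}))) = p - 3"
    unfolding cS(3)[symmetric] by (simp only: add_diff_cancel_right')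
  then have "(c \<union> {s}, c \<union> (S - {s})) \<in> overlap_pairs n p (p - 3)"
    using core_pair_multi_indices[OF cS(1,2) s(1) cS(3,4)]
    unfolding overlap_pairs_def by blast
  then show "f \<in> overlap_eqs n p (p - 3)"
    unfolding overlap_eqs_def s(2) by (intro image_eqI) auto
qed

lemma card_six_family:
  assumes "(c, S) \<in> cores n p"
  shows "card (six_family n c S :: 'a::real_normed_field lpoly set) = 6"
  using assms inj_on_six_family[of c S n p, where 'a = 'a]
  by (simp add: cores_def six_family_def card_image)

lemma partition_on_six_families:
  assumes "3 \<le> p"
  shows "partition_on (overlap_eqs n p (p - 3) :: 'a::real_normed_field lpoly set)
    ((\<lambda>(c, S). six_family n c S) ` cores n p)"
proof (rule partition_onI)
  show "\<Union>((\<lambda>(c, S). six_family n c S) ` cores n p) = (overlap_eqs n p (p - 3) :: 'a lpoly set)"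
    unfolding overlap_eqs_eq_Union_six_family[OF assms] by simp
next
  fix X Y :: "'a lpoly set"
  assume "X \<in> (\<lambda>(c, S). six_family n c S) ` cores n p" "Y \<in> (\<lambda>(c, S). six_family n c S) ` cores n p"
    and "X \<noteq> Y"
  then obtain c S c' S' where "(c, S) \<in> cores n p" "X = six_family n c S"
    "(c', S') \<in> cores n p" "Y = six_family n c' S'"
    by auto
  then show "disjnt X Y"
    using six_family_eqD[of c S n p c' S', where 'a = 'a] \<open>X \<noteq> Y\<close> by (auto simp: disjnt_iff)
next
  have "card X = 6" if "X \<in> (\<lambda>(c, S). six_family n c S) ` cores n p" for X :: "'a lpoly set"
    using that card_six_family[where 'a = 'a] by auto
  then show "{} \<notin> (\<lambda>(c, S). six_family n c S :: 'a lpoly set) ` cores n p"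
    by force
qed

text \<open>
  Counting the disjoint pairs \<open>(c, S)\<close> is the case \<open>q = 0\<close> of \<open>card_pairs_eq_multinomial\<close>.
\<close>

lemma card_six_families:
  assumes "3 \<le> p" "p + 3 \<le> n"
  shows "card ((\<lambda>(c, S). six_family n c S :: 'a::real_normed_field lpoly set) ` cores n p)
    = multinomial n [6, p - 3, n - p - 3]"
proof -
  have "inj_on (\<lambda>(c, S). six_family n c S :: 'a lpoly set) (cores n p)"
  proof (rule inj_onI, clarify)
    fix c S c' S'
    assume *: "(c, S) \<in> cores n p" "(c', S') \<in> cores n p"
      and eq: "(six_family n c S :: 'a lpoly set) = six_family n c' S'"
    have "(six_family n c S :: 'a lpoly set) \<noteq> {}"
      using card_six_family[OF *(1), where 'a = 'a] by auto
    then show "c = c' \<and> S = S'"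
      using six_family_eqD[OF *, where 'a = 'a] eq by blast
  qed
  then have "card ((\<lambda>(c, S). six_family n c S :: 'a lpoly set) ` cores n p) = card (cores n p)"
    by (rule card_image)
  also have "card (cores n p) = card {(c, S). c \<subseteq> {1..n} \<and> card c = 0 + (p - 3)
      \<and> S \<subseteq> {1..n} \<and> card S = 0 + 6 \<and> card (c \<inter> S) = 0}"
    using assms finite_subset[of _ "{1..n}"]
    by (intro arg_cong[where f = card]) (auto simp: cores_def card_eq_0_iff)
  also have "\<dots> = multinomial (card {1..n}) [0, p - 3, 6, n - p - 3]"
    using assms by (intro card_pairs_eq_multinomial) auto
  also have "\<dots> = multinomial n [6, p - 3, n - p - 3]"
    by (simp add: multinomial_def mult_ac)
  finally show ?thesis .
qed

theorem proposition2:
  fixes n p :: nat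
  assumes "2 \<le> p" and "p \<le> n - 2"
  shows
    "(\<forall>j \<in> multi_indices n (p - 2). \<forall>k \<in> multi_indices n (p + 2).
        plucker_like n j k \<noteq> (0 :: 'a::real_normed_field lpoly)) \<and>
     (\<forall>j \<in> multi_indices n (p - 2). \<forall>k \<in> multi_indices n (p + 2).
      \<forall>j' \<in> multi_indices n (p - 2). \<forall>k' \<in> multi_indices n (p + 2).
        (j, k) \<noteq> (j', k') \<longrightarrow>
        \<not> same_eqn (plucker_like n j k :: 'a lpoly) (plucker_like n j' k')) \<and>
     (\<exists>(A :: 'a lpoly set) (B :: 'a lpoly set) (C :: nat \<Rightarrow> 'a lpoly set).
        plucker_like_eqs n p = A \<union> B \<union> (\<Union>q\<in>{q. 2 * p \<le> n + q \<and> q + 4 \<le> p}. C q) \<and>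
        A \<inter> B = {} \<and>
        (A \<union> B) \<inter> (\<Union>q\<in>{q. 2 * p \<le> n + q \<and> q + 4 \<le> p}. C q) = {} \<and>
        disjoint_family_on C {q. 2 * p \<le> n + q \<and> q + 4 \<le> p} \<and>
        \<comment> \<open>(i)\<close>
        card A = multinomial n [4, p - 2, n - p - 2] \<and>
        (\<forall>f\<in>A. gives_eqn_of f (plucker_eqs n p) \<and> num_terms f = 3) \<and>
        \<comment> \<open>(ii)\<close>
        (\<not> (3 \<le> p \<and> p \<le> n - 3) \<longrightarrow> B = {}) \<and>
        (3 \<le> p \<and> p \<le> n - 3 \<longrightarrow>
           card B = multinomial n [1, 5, p - 3, n - p - 3] \<and>
           (\<forall>f\<in>B. num_terms f = 10) \<and>
           (\<exists>\<P>. partition_on B \<P> \<and>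
                card \<P> = multinomial n [6, p - 3, n - p - 3] \<and>
                (\<forall>X\<in>\<P>.
                   card X = 6 \<and>
                   (\<forall>f\<in>X. \<forall>g\<in>X. same_terms f g) \<and>
                   (\<exists>E. bij_betw E {1..6::nat} X \<and>
                     (\<exists>W \<subseteq> plucker_eqs n p.
                        card W = 15 \<and>
                        (\<forall>f\<in>W. \<forall>g\<in>W. f \<noteq> g \<longrightarrow> \<not> same_eqn f g) \<and>
                        (\<forall>f\<in>W. num_terms f = 4) \<and>
                        (\<forall>i i'. 1 \<le> i \<and> i < i' \<and> i' \<le> 6 \<longrightarrow>
                           gives_eqn_of (E i + (- 1) ^ (i + i') * E i') W)))))) \<and>
        \<comment> \<open>(iii)\<close>
        (\<forall>q. 2 * p \<le> n + q \<and> q + 4 \<le> p \<longrightarrow>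
           card (C q) = multinomial n [q, p - 2 - q, p + 2 - q, n + q - 2 * p] \<and>
           (\<forall>f\<in>C q. num_terms f = (p + 2 - q) choose 2) \<and>
           (p + 2 - q) choose 2 \<ge> 15))"
proof -
  have np: "p + 2 \<le> n"
    using assms by simp
  let ?I = "{q. 2 * p \<le> n + q \<and> q + 4 \<le> p}"
  define A where "A = (overlap_eqs n p (p - 2) :: 'a lpoly set)"
  define B where "B = (if 3 \<le> p \<and> p \<le> n - 3 then overlap_eqs n p (p - 3) else {} :: 'a lpoly set)"
  define C where "C = (overlap_eqs n p :: nat \<Rightarrow> 'a lpoly set)"

  have nonzero: "\<forall>j \<in> multi_indices n (p - 2). \<forall>k \<in> multi_indices n (p + 2).
      plucker_like n j k \<noteq> (0 :: 'a lpoly)"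
  proof (intro ballI notI)
    fix j k
    assume jk: "j \<in> multi_indices n (p - 2)" "k \<in> multi_indices n (p + 2)"
      and zero: "plucker_like n j k = (0 :: 'a lpoly)"
    have "(j, k) \<in> overlap_pairs n p (card (j \<inter> k))"
      using jk by (simp add: overlap_pairs_def)
    from overlap_pairs_bounds(1)[OF assms(1) this]
    have "(p + 2 - card (j \<inter> k)) choose 2 \<noteq> 0"
      by (auto simp: binomial_eq_0_iff)
    then show False
      using num_terms_plucker_like[OF assms(1) jk, where 'a = 'a] zero
      by (simp add: num_terms_def split: if_splits)
  qed
  have distinct: "\<forall>j \<in> multi_indices n (p - 2). \<forall>k \<in> multi_indices n (p + 2).
      \<forall>j' \<in> multi_indices n (p - 2). \<forall>k' \<in> multi_indices n (p + 2).
        (j, k) \<noteq> (j', k') \<longrightarrow>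
        \<not> same_eqn (plucker_like n j k :: 'a lpoly) (plucker_like n j' k')"
    using same_eqn_plucker_likeD[OF assms(1), where 'a = 'a] by blast

  \<comment> \<open>With overlap \<open>p - 3\<close>, the union of \<open>j\<close> and \<open>k\<close> would have \<open>p + 3 > n\<close> elements.\<close>
  have B_empty: "overlap_eqs n p (p - 3) = ({} :: 'a lpoly set)" if "3 \<le> p" "\<not> p \<le> n - 3"
  proof -
    have "\<not> 2 * p \<le> n + (p - 3)"
      using that by linarith
    then have "overlap_pairs n p (p - 3) = {}"
      using overlap_pairs_bounds(2)[OF assms(1)] by fastforce
    then show ?thesis
      by (simp add: overlap_eqs_def)
  qed
  have B_sub: "B \<subseteq> overlap_eqs n p (p - 3)"
    by (simp add: B_def)
  have union: "plucker_like_eqs n p = A \<union> B \<union> (\<Union>q\<in>?I. C q)"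
  proof
    show "plucker_like_eqs n p \<subseteq> A \<union> B \<union> (\<Union>q\<in>?I. C q)"
    proof
      fix f :: "'a lpoly"
      assume "f \<in> plucker_like_eqs n p"
      then obtain q where f: "f \<in> overlap_eqs n p q"
        by (auto simp: plucker_like_eqs_eq_Union)
      then obtain j k where "(j, k) \<in> overlap_pairs n p q"
        by (auto simp: overlap_eqs_def)
      note bounds = overlap_pairs_bounds[OF assms(1) this]
      consider "q = p - 2" | "3 \<le> p" "q = p - 3" | "q \<in> ?I"
        using bounds by fastforce
      then show "f \<in> A \<union> B \<union> (\<Union>q\<in>?I. C q)"
      proof cases
        case 2
        then show ?thesis
          using f B_empty by (cases "p \<le> n - 3") (auto simp: B_def)
      qed (use f in \<open>auto simp: A_def C_def\<close>)
    qed
    show "A \<union> B \<union> (\<Union>q\<in>?I. C q) \<subseteq> plucker_like_eqs n p"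
      using B_sub by (auto simp: A_def C_def plucker_like_eqs_eq_Union)
  qed
  have AB: "A \<inter> B = {}"
  proof (cases "3 \<le> p")
    case True
    then have "p - 2 \<noteq> p - 3"
      by linarith
    from overlap_eqs_disjoint[OF assms(1) this] show ?thesis
      unfolding A_def using B_sub by blast
  qed (simp add: B_def)
  have ABC: "(A \<union> B) \<inter> (\<Union>q\<in>?I. C q) = {}"
  proof -
    have "A \<inter> C q = {}" "B \<inter> C q = {}" if "q \<in> ?I" for q
    proof -
      have "p - 2 \<noteq> q" "p - 3 \<noteq> q"
        using that by auto
      from this[THEN overlap_eqs_disjoint[OF assms(1)]]
      show "A \<inter> C q = {}" "B \<inter> C q = {}"
        unfolding A_def C_def using B_sub by blast+
    qed
    then show ?thesis
      by blast
  qed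
  have C_disjoint: "disjoint_family_on C ?I"
    unfolding disjoint_family_on_def C_def using overlap_eqs_disjoint[OF assms(1), where 'a = 'a] by blast

  have card_A: "card A = multinomial n [4, p - 2, n - p - 2]"
  proof -
    have "card A = multinomial n [p - 2, p - 2 - (p - 2), p + 2 - (p - 2), n + (p - 2) - 2 * p]"
      unfolding A_def using assms np by (intro card_overlap_eqs) auto
    moreover have "p - 2 - (p - 2) = 0" "p + 2 - (p - 2) = 4" "n + (p - 2) - 2 * p = n - p - 2"
      using assms np by auto
    ultimately show ?thesis
      by (simp add: multinomial_def mult_ac)
  qed
  have A_eqs: "\<forall>f\<in>A. gives_eqn_of f (plucker_eqs n p) \<and> num_terms f = 3"
  proof
    fix f assume f: "f \<in> A"
    then obtain j k where "f = plucker_like n j k" "j \<in> multi_indices n (p - 2)"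
      "k \<in> multi_indices n (p + 2)" "card (j \<inter> k) = p - 2"
      by (auto simp: A_def overlap_eqs_def overlap_pairs_def)
    then show "gives_eqn_of f (plucker_eqs n p) \<and> num_terms f = 3"
      using plucker_like_subset_is_plucker[OF assms(1), of j n k, where 'a = 'a]
        num_terms_overlap_eqs[OF assms(1), of f n "p - 2"] f by (simp add: A_def)
  qed

  let ?combine = "\<lambda>X :: 'a lpoly set. \<exists>E. bij_betw E {1..6::nat} X \<and>
    (\<exists>W \<subseteq> plucker_eqs n p. card W = 15 \<and>
      (\<forall>f\<in>W. \<forall>g\<in>W. f \<noteq> g \<longrightarrow> \<not> same_eqn f g) \<and>
      (\<forall>f\<in>W. num_terms f = 4) \<and>
      (\<forall>i i'. 1 \<le> i \<and> i < i' \<and> i' \<le> 6 \<longrightarrow>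
        gives_eqn_of (E i + (- 1) ^ (i + i') * E i') W))"
  have B_part: "card B = multinomial n [1, 5, p - 3, n - p - 3] \<and>
      (\<forall>f\<in>B. num_terms f = 10) \<and>
      (\<exists>\<P>. partition_on B \<P> \<and>
        card \<P> = multinomial n [6, p - 3, n - p - 3] \<and>
        (\<forall>X\<in>\<P>. card X = 6 \<and> (\<forall>f\<in>X. \<forall>g\<in>X. same_terms f g) \<and> ?combine X))"
    if p3: "3 \<le> p \<and> p \<le> n - 3"
  proof (intro conjI)
    have B: "B = overlap_eqs n p (p - 3)"
      using p3 by (simp add: B_def)
    have "card B = multinomial n [p - 3, p - 2 - (p - 3), p + 2 - (p - 3), n + (p - 3) - 2 * p]"
      unfolding B using p3 assms by (intro card_overlap_eqs) auto
    moreover have "p - 2 - (p - 3) = 1" "p + 2 - (p - 3) = 5" "n + (p - 3) - 2 * p = n - p - 3"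
      using p3 by auto
    ultimately show "card B = multinomial n [1, 5, p - 3, n - p - 3]"
      by (simp add: multinomial_def mult_ac)
    show "\<forall>f\<in>B. num_terms f = 10"
    proof
      fix f assume "f \<in> B"
      then have "num_terms f = (p + 2 - (p - 3)) choose 2"
        using num_terms_overlap_eqs[OF assms(1), of f n "p - 3"] p3 unfolding B by auto
      moreover have "p + 2 - (p - 3) = 5"
        using p3 by auto
      ultimately show "num_terms f = 10"
        by (simp add: choose_two)
    qed
    show "\<exists>\<P>. partition_on B \<P> \<and>
        card \<P> = multinomial n [6, p - 3, n - p - 3] \<and>
        (\<forall>X\<in>\<P>. card X = 6 \<and> (\<forall>f\<in>X. \<forall>g\<in>X. same_terms f g) \<and> ?combine X)"
    proof (rule exI[of _ "(\<lambda>(c, S). six_family n c S) ` cores n p"], intro conjI ballI)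
      show "partition_on B ((\<lambda>(c, S). six_family n c S) ` cores n p)"
        unfolding B using p3 by (intro partition_on_six_families) simp
      show "card ((\<lambda>(c, S). six_family n c S :: 'a lpoly set) ` cores n p)
          = multinomial n [6, p - 3, n - p - 3]"
        using p3 assms by (intro card_six_families) auto
    next
      fix X :: "'a lpoly set"
      assume "X \<in> (\<lambda>(c, S). six_family n c S) ` cores n p"
      then obtain c S where core: "(c, S) \<in> cores n p" and X: "X = six_family n c S"
        by auto
      then have cS: "c \<union> S \<subseteq> {1..n}" "c \<inter> S = {}" "card c + 3 = p" "card S = 6"
        by (simp_all add: cores_def)
      show "card X = 6"
        unfolding X by (rule card_six_family[OF core])
      show "same_terms f g" if "f \<in> X" "g \<in> X" for f g
        using that unfolding X by (rule same_terms_six_family[OF cS(1,2,4)])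
      show "?combine X"
        unfolding X by (rule six_family_combinations[OF cS])
    qed
  qed

  have C_part: "\<forall>q. 2 * p \<le> n + q \<and> q + 4 \<le> p \<longrightarrow>
      card (C q) = multinomial n [q, p - 2 - q, p + 2 - q, n + q - 2 * p] \<and>
      (\<forall>f\<in>C q. num_terms f = (p + 2 - q) choose 2) \<and>
      (p + 2 - q) choose 2 \<ge> 15"
  proof (intro allI impI)
    fix q assume q: "2 * p \<le> n + q \<and> q + 4 \<le> p"
    have "card (C q) = multinomial n [q, p - 2 - q, p + 2 - q, n + q - 2 * p]"
      unfolding C_def using q assms by (intro card_overlap_eqs) auto
    moreover have "num_terms f = (p + 2 - q) choose 2" if "f \<in> C q" for f
      using num_terms_overlap_eqs[OF assms(1), of f n q] that q unfolding C_def by auto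
    moreover have "(6 choose 2 :: nat) \<le> (p + 2 - q) choose 2"
      using q by (intro binomial_right_mono) auto
    ultimately show "card (C q) = multinomial n [q, p - 2 - q, p + 2 - q, n + q - 2 * p] \<and>
        (\<forall>f\<in>C q. num_terms f = (p + 2 - q) choose 2) \<and> (p + 2 - q) choose 2 \<ge> 15"
      by (simp add: choose_two[of 6])
  qed

  have B_trivial: "\<not> (3 \<le> p \<and> p \<le> n - 3) \<longrightarrow> B = {}"
    unfolding B_def by simp
  show ?thesis
    by (intro conjI[OF nonzero] conjI[OF distinct],
        rule exI[of _ A], rule exI[of _ B], rule exI[of _ C])
      (intro conjI union AB ABC C_disjoint card_A A_eqs B_trivial B_part[unfolded atomize_imp] C_part)
qed

end
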